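(* Let $\mathcal{T}$ be a locally finite, vertex-to-vertex parallelogram tiling of $\mathbb{R}^2$, with finite or infinite protoset. Denote the infimum of all interior angles of the prototiles by $\alpha$. If $\alpha>0$, then any two tiles $S,T$ in $\mathcal{T}$ can be connected by a finite sequence of tiles which are contained in a finite number of worms; that is, there are finitely many worms and a finite sequence of tiles $S=S_0,S_1,\ldots,S_n=T$ such that any two successive tiles $S_{i},S_{i+1}$ are neighbouring members of one of these worms. Moreover, less than $\lceil 2\pi/\alpha\rceil$ different worms are needed.
   Context: A parallelogram tiling is a countable collection $\mathcal{T}=\{T_1,T_2,\ldots\}$ of non-degenerate (nonempty interior) closed parallelograms in $\mathbb{R}^2$, called tiles, with $\bigcup_i T_i=\mathbb{R}^2$ and $\operatorname{int}(T_i)\cap\operatorname{int}(T_j)=\varnothing$ for $i\neq j$. It is locally finite if each ball in $\mathbb{R}^2$ intersects only finitely many tiles. It is vertex-to-vertex if, whenever $x\in\mathbb{R}^2$ is a vertex of some tile $T\in\mathcal{T}$ and $x\in T'\in\mathcal{T}$, then $x$ is a vertex of $T'$. The protoset of $\mathcal{T}$ is the set of congruence classes of tiles in $\mathcal{T}$; its elements are called prototiles. Worms: let $T$ be a tile and $e$ one of its edges. There is a unique tile $T_1\neq T$ sharing the edge $e$ with $T$. Let $e_1\neq e$ be the edge of $T_1$ parallel to $e$; there is a unique tile $T_2\neq T_1$ sharing $e_1$ with $T_1$. Repeating this gives a one-sided infinite sequence $T,T_1,T_2,\ldots$; doing the same starting from the edge of $T$ opposite to $e$ gives $T_{-1},T_{-2},\ldots$.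 The biinfinite sequence $\ldots,T_{-2},T_{-1},T,T_1,T_2,\ldots$ is called the worm given by $T$ and $e$; any such sequence is called a worm. Worms are identified if they differ only by an index shift and/or reversal. $\lceil x\rceil$ denotes the smallest integer $k$ with $k\geq x$. *)

theory Defs
  imports "HOL-Analysis.Analysis"
begin

type_synonym plane = "real ^ 2"

definition parallelogram :: "plane set \<Rightarrow> bool" where
  "parallelogram P \<longleftrightarrow>
     (\<exists>p u v. P = convex hull {p, p + u, p + v, p + u + v}) \<and> interior P \<noteq> {}"

definition parallelogram_tiling :: "plane set set \<Rightarrow> bool" where
  "parallelogram_tiling \<T> \<longleftrightarrow>
     countable \<T> \<and> (\<forall>A\<in>\<T>. parallelogram A) \<and> \<Union>\<T> = UNIV \<and>
     (\<forall>A\<in>\<T>. \<forall>B\<in>\<T>. A \<noteq> B \<longrightarrow> interior A \<inter> interior B = {})"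

definition locally_finite_tiling :: "plane set set \<Rightarrow> bool" where
  "locally_finite_tiling \<T> \<longleftrightarrow> (\<forall>x r. finite {A \<in> \<T>. A \<inter> ball x r \<noteq> {}})"

text \<open>The vertices and edges of a tile are its extreme points and its one-dimensional faces.\<close>

definition vertex_to_vertex :: "plane set set \<Rightarrow> bool" where
  "vertex_to_vertex \<T> \<longleftrightarrow>
     (\<forall>x. \<forall>A\<in>\<T>. \<forall>B\<in>\<T>. x extreme_point_of A \<and> x \<in> B \<longrightarrow> x extreme_point_of B)"

definition congruent_sets :: "plane set \<Rightarrow> plane set \<Rightarrow> bool" where
  "congruent_sets A B \<longleftrightarrow> (\<exists>f. (\<forall>x y. dist (f x) (f y) = dist x y) \<and> f ` A = B)"

definition protoset :: "plane set set \<Rightarrow> plane set set set" where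
  "protoset \<T> = \<T> // {(A, B). A \<in> \<T> \<and> B \<in> \<T> \<and> congruent_sets A B}"

text \<open>The interior angle at a vertex \<open>x\<close> is the angle between the two edges of the polygon
  that issue from \<open>x\<close>.\<close>

definition interior_angles :: "plane set \<Rightarrow> real set" where
  "interior_angles A =
     {arccos ((y - x) \<bullet> (z - x) / (norm (y - x) * norm (z - x))) | x y z.
        y \<noteq> z \<and> closed_segment x y edge_of A \<and> closed_segment x z edge_of A}"

text \<open>Congruent tiles have the same interior angles, so for a congruence class the union below
  is the set of interior angles of any one of its members.\<close>

definition prototile_angles :: "plane set set \<Rightarrow> real set" where
  "prototile_angles P = (\<Union>A\<in>P. interior_angles A)"

definition parallel_edges :: "plane set \<Rightarrow> plane set \<Rightarrow> bool" where
  "parallel_edges e f \<longleftrightarrow> affine_parallel (affine hull e) (affine hull f)"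

text \<open>In the next definition, \<open>\<epsilon> i\<close> is the edge shared by the successive tiles \<open>w i\<close> and
  \<open>w (i + 1)\<close>. In particular \<open>\<epsilon> (- 1)\<close> is the edge of the initial tile opposite to \<open>e\<close>,
  where the half of the worm with negative indices starts.\<close>

definition worm_given_by ::
    "plane set set \<Rightarrow> plane set \<Rightarrow> plane set \<Rightarrow> (int \<Rightarrow> plane set) \<Rightarrow> bool" where
  "worm_given_by \<T> A e w \<longleftrightarrow>
     w 0 = A \<and>
     (\<exists>\<epsilon>. \<epsilon> 0 = e \<and>
       (\<forall>i. w i \<in> \<T> \<and> w (i + 1) \<noteq> w i \<and>
            \<epsilon> i edge_of w i \<and> \<epsilon> i edge_of w (i + 1) \<and>
            \<epsilon> (i + 1) \<noteq> \<epsilon> i \<and> parallel_edges (\<epsilon> (i + 1)) (\<epsilon> i)))"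

definition worm_sequence :: "plane set set \<Rightarrow> (int \<Rightarrow> plane set) \<Rightarrow> bool" where
  "worm_sequence \<T> w \<longleftrightarrow> (\<exists>A\<in>\<T>. \<exists>e. e edge_of A \<and> worm_given_by \<T> A e w)"

definition worm_rel :: "plane set set \<Rightarrow> ((int \<Rightarrow> plane set) \<times> (int \<Rightarrow> plane set)) set" where
  "worm_rel \<T> = {(w, w'). worm_sequence \<T> w \<and> worm_sequence \<T> w' \<and>
     (\<exists>k. w' = (\<lambda>i. w (i + k)) \<or> w' = (\<lambda>i. w (k - i)))}"

text \<open>A worm is a class of sequences modulo index shift and reversal.\<close>

definition worms :: "plane set set \<Rightarrow> (int \<Rightarrow> plane set) set set" where
  "worms \<T> = {w. worm_sequence \<T> w} // worm_rel \<T>"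

definition neighbours_in_worm :: "(int \<Rightarrow> plane set) set \<Rightarrow> plane set \<Rightarrow> plane set \<Rightarrow> bool" where
  "neighbours_in_worm W A B \<longleftrightarrow>
     (\<exists>w\<in>W. \<exists>i. (A = w i \<and> B = w (i + 1)) \<or> (A = w (i + 1) \<and> B = w i))"

end

theory Submission imports Defs begin

text \<open>The line through the centres of the tiles of a worm with shared edge direction \<open>u\<close> is a
  Lipschitz graph over the direction orthogonal to \<open>u\<close>, because all angles are at least \<open>\<alpha>\<close>; it
  extends to infinity both ways, so it separates the plane, and two such lines meet only if the
  worms have a common tile. Two worms through a common tile with different edge directions cross
  exactly once.

  Let \<open>t\<close> be the centre of \<open>T\<close>, and let \<open>Y\<close> be a worm through \<open>T\<close> with edge direction \<open>y\<close>. Start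
  with a worm through \<open>S\<close> whose positive side contains \<open>t\<close>. From a worm with edge direction \<open>u\<close>
  having \<open>t\<close> on its positive side, local finiteness yields a transversal worm, crossing it not
  above \<open>t\<close>, that again has \<open>t\<close> on its positive side; its edge direction \<open>u'\<close> arises from \<open>u\<close> by a
  rotation by at least \<open>\<alpha>\<close>, always in the same sense. As long as the worms stay disjoint from \<open>Y\<close>,
  they lie on one side of \<open>Y\<close>, which forces the angle from \<open>y\<close> to \<open>- u\<close> to stay below \<open>pi - \<alpha>\<close>.
  So after fewer than \<open>pi / \<alpha>\<close> steps the spiral meets \<open>Y\<close>, and fewer than \<open>pi / \<alpha> + 2\<close>, which is at
  most \<open>2 * pi / \<alpha>\<close>, worms have been used.\<close>

section \<open>Parallelograms\<close>

text \<open>All geometry is expressed through the determinant \<open>cross2\<close>, whose sign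
  records sides and orientations. No separation theorem for curves is needed: an axis is a graph
  over the normal of its shared edges, so its two sides are the signs of \<open>offset\<close>, and
  a connected set that avoids the axis stays on one side by continuity. The main obstacle is that
  \<open>vangle\<close> measures angles only up to pi, while a spiral might turn further. Successive
  rotations add up only while \<open>- u\<close> stays in one closed half-plane bounded by the line
  of \<open>y\<close>. Hence \<open>\<sigma>\<close> is chosen at the start so that
  \<open>- u\<close> lies in that half-plane, and every step has to show that the next direction
  does not leave it. There \<open>Y\<close> acts as a barrier: the ray from \<open>t\<close> in
  direction \<open>- y\<close> lies on its nonpositive side, where a worm on the positive side
  cannot go. The last inequality of the count needs \<open>\<alpha> \<le> pi / 2\<close>, which
  holds because neighbouring angles of a parallelogram are supplementary. For the same reason the
  slope bound \<open>cot \<alpha>\<close> of the axes is two-sided.\<close>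

definition cross2 :: "plane \<Rightarrow> plane \<Rightarrow> real" where
  "cross2 x y = x $ 1 * y $ 2 - x $ 2 * y $ 1"

lemma plane_eq_iff: "(x::plane) = y \<longleftrightarrow> x $ 1 = y $ 1 \<and> x $ 2 = y $ 2"
  by (simp add: vec_eq_iff forall_2)

lemma inner_plane: "(x::plane) \<bullet> y = x $ 1 * y $ 1 + x $ 2 * y $ 2"
  by (simp add: inner_vec_def sum_2)

lemma cross2_simps:
  "cross2 (x + y) z = cross2 x z + cross2 y z"
  "cross2 z (x + y) = cross2 z x + cross2 z y"
  "cross2 (x - y) z = cross2 x z - cross2 y z"
  "cross2 z (x - y) = cross2 z x - cross2 z y"
  "cross2 (a *\<^sub>R x) z = a * cross2 x z"
  "cross2 z (a *\<^sub>R x) = a * cross2 z x"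
  "cross2 (- x) z = - cross2 x z"
  "cross2 z (- x) = - cross2 z x"
  "cross2 x x = 0"
  "cross2 0 x = 0"
  "cross2 x 0 = 0"
  by (simp_all add: cross2_def algebra_simps)

lemma cross2_commute: "cross2 x y = - cross2 y x"
  by (simp add: cross2_def)

text \<open>Cramer's rule.\<close>

lemma cross2_decompose:
  assumes "cross2 u v \<noteq> 0"
  shows "p = (cross2 p v / cross2 u v) *\<^sub>R u + (cross2 u p / cross2 u v) *\<^sub>R v"
proof -
  have "cross2 u v * p $ i = cross2 p v * u $ i + cross2 u p * v $ i" for i
    using exhaust_2[of i] by (auto simp: cross2_def algebra_simps)
  then have "p $ i = cross2 p v / cross2 u v * u $ i + cross2 u p / cross2 u v * v $ i" for i
    using assms by (simp add: field_simps)
  then show ?thesis by (simp add: vec_eq_iff)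
qed

lemma cross2_sq: "(cross2 x y)\<^sup>2 = (norm x)\<^sup>2 * (norm y)\<^sup>2 - (x \<bullet> y)\<^sup>2"
  by (simp add: cross2_def power2_norm_eq_inner inner_plane)
    (simp add: power2_eq_square algebra_simps)

lemma cross2_le: "\<bar>cross2 x y\<bar> \<le> norm x * norm y"
proof -
  have "(cross2 x y)\<^sup>2 \<le> (norm x * norm y)\<^sup>2"
    by (simp add: cross2_sq power_mult_distrib)
  then show ?thesis by (simp add: abs_le_square_iff[symmetric] abs_mult)
qed

lemma continuous_on_cross2 [continuous_intros]:
  fixes f g :: "'a::topological_space \<Rightarrow> plane"
  assumes "continuous_on S f" "continuous_on S g"
  shows "continuous_on S (\<lambda>x. cross2 (f x) (g x))"
  unfolding cross2_def
  by (intro continuous_intros assms)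

text \<open>Centre and half-sides are used instead of a corner and sides because swapping or
  negating the half-sides keeps the set and brings any edge into the position with midpoint
  \<open>c + v\<close>. The tile beyond that edge then has a centre of the form
  \<open>c + v + v'\<close>.\<close>

definition para :: "plane \<Rightarrow> plane \<Rightarrow> plane \<Rightarrow> plane set" where
  "para c u v = {c + x *\<^sub>R u + y *\<^sub>R v | x y. \<bar>x\<bar> \<le> 1 \<and> \<bar>y\<bar> \<le> 1}"

definition para_open :: "plane \<Rightarrow> plane \<Rightarrow> plane \<Rightarrow> plane set" where
  "para_open c u v = {c + x *\<^sub>R u + y *\<^sub>R v | x y. \<bar>x\<bar> < 1 \<and> \<bar>y\<bar> < 1}"

lemma paraI: "\<bar>x\<bar> \<le> 1 \<Longrightarrow> \<bar>y\<bar> \<le> 1 \<Longrightarrow> c + x *\<^sub>R u + y *\<^sub>R v \<in> para c u v"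
  unfolding para_def by blast

lemma para_uminus: "para c (- u) v = para c u v" "para c u (- v) = para c u v"
proof -
  have 1: "para c (- u) v \<subseteq> para c u v" for u v
  proof
    fix p assume "p \<in> para c (- u) v"
    then obtain x y where "p = c + (- x) *\<^sub>R u + y *\<^sub>R v" "\<bar>x\<bar> \<le> 1" "\<bar>y\<bar> \<le> 1"
      unfolding para_def by auto
    then show "p \<in> para c u v" using paraI[of "- x" y] by simp
  qed
  have 2: "para c u (- v) \<subseteq> para c u v" for u v
  proof
    fix p assume "p \<in> para c u (- v)"
    then obtain x y where "p = c + x *\<^sub>R u + (- y) *\<^sub>R v" "\<bar>x\<bar> \<le> 1" "\<bar>y\<bar> \<le> 1"
      unfolding para_def by auto
    then show "p \<in> para c u v" using paraI[of x "- y" c u v] by simp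
  qed
  show "para c (- u) v = para c u v" "para c u (- v) = para c u v"
    using 1[of u v] 1[of "-u" v] 2[of u v] 2[of u "-v"] by simp_all
qed

lemma para_swap: "para c v u = para c u v"
proof -
  have "para c v u \<subseteq> para c u v" for u v
  proof
    fix p assume "p \<in> para c v u"
    then obtain x y where "p = c + y *\<^sub>R u + x *\<^sub>R v" "\<bar>x\<bar> \<le> 1" "\<bar>y\<bar> \<le> 1"
      unfolding para_def by (auto simp: add_ac)
    then show "p \<in> para c u v" using paraI[of y x] by simp
  qed
  then show ?thesis by blast
qed

lemma mem_para_iff:
  assumes "cross2 u v \<noteq> 0"
  shows "p \<in> para c u v \<longleftrightarrow> \<bar>cross2 (p - c) v\<bar> \<le> \<bar>cross2 u v\<bar> \<and> \<bar>cross2 u (p - c)\<bar> \<le> \<bar>cross2 u v\<bar>"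
proof
  assume "p \<in> para c u v"
  then obtain x y where "p = c + x *\<^sub>R u + y *\<^sub>R v" "\<bar>x\<bar> \<le> 1" "\<bar>y\<bar> \<le> 1"
    unfolding para_def by auto
  then show "\<bar>cross2 (p - c) v\<bar> \<le> \<bar>cross2 u v\<bar> \<and> \<bar>cross2 u (p - c)\<bar> \<le> \<bar>cross2 u v\<bar>"
    by (simp add: cross2_simps abs_mult mult_left_le_one_le)
next
  assume *: "\<bar>cross2 (p - c) v\<bar> \<le> \<bar>cross2 u v\<bar> \<and> \<bar>cross2 u (p - c)\<bar> \<le> \<bar>cross2 u v\<bar>"
  have "p = c + (cross2 (p - c) v / cross2 u v) *\<^sub>R u + (cross2 u (p - c) / cross2 u v) *\<^sub>R v"
    using cross2_decompose[OF assms, of "p - c"] by (simp add: algebra_simps)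
  moreover have "\<bar>cross2 (p - c) v / cross2 u v\<bar> \<le> 1" "\<bar>cross2 u (p - c) / cross2 u v\<bar> \<le> 1"
    using * assms by (simp_all add: abs_divide)
  ultimately show "p \<in> para c u v" using paraI by metis
qed

lemma mem_para_open_iff:
  assumes "cross2 u v \<noteq> 0"
  shows "p \<in> para_open c u v \<longleftrightarrow> \<bar>cross2 (p - c) v\<bar> < \<bar>cross2 u v\<bar> \<and> \<bar>cross2 u (p - c)\<bar> < \<bar>cross2 u v\<bar>"
proof
  assume "p \<in> para_open c u v"
  then obtain x y where "p = c + x *\<^sub>R u + y *\<^sub>R v" "\<bar>x\<bar> < 1" "\<bar>y\<bar> < 1"
    unfolding para_open_def by auto
  then show "\<bar>cross2 (p - c) v\<bar> < \<bar>cross2 u v\<bar> \<and> \<bar>cross2 u (p - c)\<bar> < \<bar>cross2 u v\<bar>"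
    using assms by (simp add: cross2_simps abs_mult)
next
  assume *: "\<bar>cross2 (p - c) v\<bar> < \<bar>cross2 u v\<bar> \<and> \<bar>cross2 u (p - c)\<bar> < \<bar>cross2 u v\<bar>"
  have "p = c + (cross2 (p - c) v / cross2 u v) *\<^sub>R u + (cross2 u (p - c) / cross2 u v) *\<^sub>R v"
    using cross2_decompose[OF assms, of "p - c"] by (simp add: algebra_simps)
  moreover have "\<bar>cross2 (p - c) v / cross2 u v\<bar> < 1" "\<bar>cross2 u (p - c) / cross2 u v\<bar> < 1"
    using * assms by (simp_all add: abs_divide)
  ultimately show "p \<in> para_open c u v" unfolding para_open_def by blast
qed

lemma open_para_open:
  assumes "cross2 u v \<noteq> 0"
  shows "open (para_open c u v)"
proof -
  have "para_open c u v = {p. \<bar>cross2 (p - c) v\<bar> < \<bar>cross2 u v\<bar>} \<inter> {p. \<bar>cross2 u (p - c)\<bar> < \<bar>cross2 u v\<bar>}"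
    using mem_para_open_iff[OF assms] by blast
  also have "open \<dots>"
    by (intro open_Int open_Collect_less continuous_intros)
  finally show ?thesis .
qed

lemma para_open_subset_interior:
  assumes "cross2 u v \<noteq> 0"
  shows "para_open c u v \<subseteq> interior (para c u v)"
proof (rule interior_maximal[OF _ open_para_open[OF assms]])
  show "para_open c u v \<subseteq> para c u v"
    unfolding para_open_def para_def using less_imp_le by blast
qed

lemma closed_para:
  assumes "cross2 u v \<noteq> 0"
  shows "closed (para c u v)"
proof -
  have "para c u v = {p. \<bar>cross2 (p - c) v\<bar> \<le> \<bar>cross2 u v\<bar>} \<inter> {p. \<bar>cross2 u (p - c)\<bar> \<le> \<bar>cross2 u v\<bar>}"
    using mem_para_iff[OF assms] by blast
  also have "closed \<dots>"
    by (intro closed_Int closed_Collect_le continuous_intros)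
  finally show ?thesis .
qed

lemma convex_para: "convex (para c u v)"
proof -
  have "para c u v = (\<lambda>p. c + p) ` ((\<lambda>z. fst z *\<^sub>R u + snd z *\<^sub>R v) ` ({-1..1} \<times> {-1..1}))"
  proof (intro set_eqI iffI)
    fix p assume "p \<in> para c u v"
    then obtain x y where "p = c + x *\<^sub>R u + y *\<^sub>R v" "\<bar>x\<bar> \<le> 1" "\<bar>y\<bar> \<le> 1"
      unfolding para_def by auto
    then show "p \<in> (\<lambda>p. c + p) ` ((\<lambda>z. fst z *\<^sub>R u + snd z *\<^sub>R v) ` ({-1..1} \<times> {-1..1}))"
      by (intro image_eqI[where x = "x *\<^sub>R u + y *\<^sub>R v"] image_eqI[where x = "(x, y)"]) (auto simp: add.assoc)
  next
    fix p assume "p \<in> (\<lambda>p. c + p) ` ((\<lambda>z. fst z *\<^sub>R u + snd z *\<^sub>R v) ` ({-1..1} \<times> {-1..1}))"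
    then obtain x y where "p = c + x *\<^sub>R u + y *\<^sub>R v" "x \<in> {-1..1}" "y \<in> {-1..1}"
      by (auto simp: add.assoc)
    then show "p \<in> para c u v" using paraI[of x y c u v] by auto
  qed
  moreover have "linear (\<lambda>z::real \<times> real. fst z *\<^sub>R u + snd z *\<^sub>R v)"
    by (rule linearI) (auto simp: algebra_simps)
  moreover have "convex ({-1..1::real} \<times> {-1..1::real})"
    by (intro convex_Times convex_real_interval)
  ultimately show ?thesis
    by (simp only: convex_linear_image convex_translation)
qed

lemma open_meets_para_open:
  assumes "open U" "p \<in> U" "p \<in> para c u v"
  shows "\<exists>q\<in>U. q \<in> para_open c u v"
proof -
  obtain x y where p: "p = c + x *\<^sub>R u + y *\<^sub>R v" "\<bar>x\<bar> \<le> 1" "\<bar>y\<bar> \<le> 1"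
    using assms unfolding para_def by auto
  have "((\<lambda>s. c + (s * x) *\<^sub>R u + (s * y) *\<^sub>R v) \<longlongrightarrow> c + (1 * x) *\<^sub>R u + (1 * y) *\<^sub>R v) (at_left 1)"
    by (intro tendsto_intros)
  then have "((\<lambda>s. c + (s * x) *\<^sub>R u + (s * y) *\<^sub>R v) \<longlongrightarrow> p) (at_left 1)"
    by (simp add: p)
  then have "\<forall>\<^sub>F s in at_left 1. c + (s * x) *\<^sub>R u + (s * y) *\<^sub>R v \<in> U"
    using assms(1,2) topological_tendstoD by blast
  moreover have "\<forall>\<^sub>F s::real in at_left 1. s \<in> {0<..<1}"
    by (rule eventually_at_left_real) simp
  ultimately have "\<forall>\<^sub>F s in at_left 1. c + (s * x) *\<^sub>R u + (s * y) *\<^sub>R v \<in> U \<and> 0 < s \<and> s < 1"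
    by eventually_elim auto
  then obtain s where s: "c + (s * x) *\<^sub>R u + (s * y) *\<^sub>R v \<in> U" "0 < s" "s < 1"
    using eventually_happens' by (metis (no_types, lifting) trivial_limit_at_left_real)
  have "\<bar>s * z\<bar> < 1" if "\<bar>z\<bar> \<le> 1" for z
  proof -
    have "\<bar>s * z\<bar> \<le> s * 1" unfolding abs_mult using s that by (intro mult_mono) auto
    then show ?thesis using s by simp
  qed
  then have "\<bar>s * x\<bar> < 1" "\<bar>s * y\<bar> < 1" using p by auto
  then show ?thesis using s unfolding para_open_def by blast
qed

lemma parallelogram_para:
  assumes "parallelogram P"
  obtains c u v where "P = para c u v" "cross2 u v \<noteq> 0"
proof -
  obtain p a b where P: "P = convex hull {p, p + a, p + b, p + a + b}" and int: "interior P \<noteq> {}"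
    using assms unfolding parallelogram_def by blast
  define u v c where "u = (1/2) *\<^sub>R a" and "v = (1/2) *\<^sub>R b" and "c = p + u + v"
  have abp: "a = 2 *\<^sub>R u" "b = 2 *\<^sub>R v" "p = c - u - v"
    by (simp_all add: u_def v_def c_def)
  have eq: "P = para c u v"
  proof
    have "c + x *\<^sub>R u + y *\<^sub>R v \<in> para c u v" if "x = 1 \<or> x = -1" "y = 1 \<or> y = -1" for x y
      by (rule paraI) (use that in auto)
    from this[of "-1" "-1"] this[of "-1" 1] this[of 1 "-1"] this[of 1 1]
    have "{p, p + a, p + b, p + a + b} \<subseteq> para c u v"
      by (simp add: abp scaleR_2 algebra_simps)
    then show "P \<subseteq> para c u v"
      unfolding P by (rule hull_minimal) (rule convex_para)
    show "para c u v \<subseteq> P"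
    proof
      fix z assume "z \<in> para c u v"
      then obtain x y where z: "z = c + x *\<^sub>R u + y *\<^sub>R v" "\<bar>x\<bar> \<le> 1" "\<bar>y\<bar> \<le> 1"
        unfolding para_def by auto
      have cv: "convex P" unfolding P by simp
      have v: "p \<in> P" "p + a \<in> P" "p + b \<in> P" "p + a + b \<in> P"
        unfolding P by (simp_all add: hull_inc)
      define X Y where "X = (x + 1) / 2" and "Y = (y + 1) / 2"
      have XY: "0 \<le> X" "X \<le> 1" "0 \<le> Y" "Y \<le> 1" using z by (auto simp: X_def Y_def)
      have e: "(1 - X) *\<^sub>R p + X *\<^sub>R (p + a) \<in> P" "(1 - X) *\<^sub>R (p + b) + X *\<^sub>R (p + a + b) \<in> P"
        using cv v XY by (simp_all add: convex_alt)
      have "(1 - Y) *\<^sub>R ((1 - X) *\<^sub>R p + X *\<^sub>R (p + a)) + Y *\<^sub>R ((1 - X) *\<^sub>R (p + b) + X *\<^sub>R (p + a + b)) \<in> P"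
        using cv e XY by (simp add: convex_alt)
      moreover have "z = (1 - Y) *\<^sub>R ((1 - X) *\<^sub>R p + X *\<^sub>R (p + a)) + Y *\<^sub>R ((1 - X) *\<^sub>R (p + b) + X *\<^sub>R (p + a + b))"
        by (simp add: plane_eq_iff z abp X_def Y_def field_simps)
      ultimately show "z \<in> P" by simp
    qed
  qed
  have "cross2 u v \<noteq> 0"
  proof
    assume d: "cross2 u v = 0"
    \<comment> \<open>A nonzero vector parallel to both half-sides; if both vanish, any nonzero
      vector serves.\<close>
    obtain w where w: "w \<noteq> 0" "cross2 w u = 0" "cross2 w v = 0"
    proof (cases "u = 0")
      case True
      then show ?thesis using that[of "if v = 0 then 1 else v"] by (auto simp: cross2_simps)
    next
      case False
      then show ?thesis using that[of u] d by (auto simp: cross2_simps)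
    qed
    have flat: "cross2 w (z - c) = 0" if "z \<in> P" for z
      using that w unfolding eq para_def by (auto simp: cross2_simps)
    obtain z e where z: "e > 0" "ball z e \<subseteq> P"
      using int by (auto simp: mem_interior)
    define n :: plane where "n = vector [- (w $ 2), w $ 1]"
    have n: "cross2 w n = w \<bullet> w"
      by (simp add: n_def cross2_def inner_plane)
    then have n0: "norm n > 0" using w by (auto simp: cross2_simps)
    have "z + (e / (2 * norm n)) *\<^sub>R n \<in> ball z e"
      using n0 z by (simp add: dist_norm)
    then have "cross2 w (z + (e / (2 * norm n)) *\<^sub>R n - c) = 0" "cross2 w (z - c) = 0"
      using flat z by (blast, metis centre_in_ball subsetD)
    then have "(e / (2 * norm n)) * (w \<bullet> w) = 0"
      by (simp add: cross2_simps n)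
    then show False using z n0 w by auto
  qed
  then show ?thesis using that eq by blast
qed

lemma edge_of_para:
  assumes "cross2 u v \<noteq> 0"
  shows "closed_segment (c + v - u) (c + v + u) edge_of para c u v"
proof -
  \<comment> \<open>The normal of the supporting line that cuts out the edge: \<open>u\<close>
    turned by a right angle, with the sign that makes its inner product with \<open>v\<close>
    positive.\<close>
  define n :: plane where "n = (if cross2 u v > 0 then 1 else -1) *\<^sub>R vector [- (u $ 2), u $ 1]"
  have n: "n \<bullet> p = sgn (cross2 u v) * cross2 u p" for p
    using assms by (auto simp: n_def inner_plane cross2_def sgn_if)
  have nv: "n \<bullet> v = \<bar>cross2 u v\<bar>" "n \<bullet> u = 0" by (auto simp: n sgn_if cross2_simps)
  have le: "n \<bullet> x \<le> n \<bullet> (c + v)" if mem: "x \<in> para c u v" for x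
  proof -
    obtain a b where x: "x = c + a *\<^sub>R u + b *\<^sub>R v" "b \<le> 1"
      using mem unfolding para_def by auto
    have "b * \<bar>cross2 u v\<bar> \<le> 1 * \<bar>cross2 u v\<bar>" using x by (intro mult_right_mono) auto
    then show ?thesis by (simp add: x inner_add_right nv)
  qed
  have "para c u v \<inter> {x. n \<bullet> x = n \<bullet> (c + v)} face_of para c u v"
    by (rule face_of_Int_supporting_hyperplane_le[OF convex_para le])
  moreover have "para c u v \<inter> {x. n \<bullet> x = n \<bullet> (c + v)} = closed_segment (c + v - u) (c + v + u)"
  proof (intro set_eqI iffI)
    fix z assume "z \<in> para c u v \<inter> {x. n \<bullet> x = n \<bullet> (c + v)}"
    then obtain x y where z: "z = c + x *\<^sub>R u + y *\<^sub>R v" "\<bar>x\<bar> \<le> 1" "n \<bullet> z = n \<bullet> (c + v)"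
      unfolding para_def by auto
    then have "y * \<bar>cross2 u v\<bar> = 1 * \<bar>cross2 u v\<bar>" by (simp add: inner_add_right nv)
    then have "y = 1" using assms unfolding mult_cancel_right by simp
    then have "z = (1 - (x + 1) / 2) *\<^sub>R (c + v - u) + ((x + 1) / 2) *\<^sub>R (c + v + u)"
      by (simp add: plane_eq_iff z field_simps)
    then show "z \<in> closed_segment (c + v - u) (c + v + u)"
      using z(2) unfolding in_segment by (intro exI[of _ "(x + 1) / 2"]) auto
  next
    fix z assume "z \<in> closed_segment (c + v - u) (c + v + u)"
    then obtain s where s: "0 \<le> s" "s \<le> 1" "z = (1 - s) *\<^sub>R (c + v - u) + s *\<^sub>R (c + v + u)"
      unfolding in_segment by auto
    then have z: "z = c + (2 * s - 1) *\<^sub>R u + 1 *\<^sub>R v"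
      by (simp add: plane_eq_iff field_simps)
    then show "z \<in> para c u v \<inter> {x. n \<bullet> x = n \<bullet> (c + v)}"
      using s(1,2) paraI[of "2 * s - 1" 1 c u v] by (simp add: inner_add_right nv abs_le_iff)
  qed
  moreover have "aff_dim (closed_segment (c + v - u) (c + v + u)) = 1"
  proof -
    have "u \<noteq> 0" using assms by (auto simp: cross2_simps)
    then have "c + v - u \<noteq> c + v + u"
      by (auto simp: plane_eq_iff)
    then show ?thesis
      by (simp add: segment_convex_hull aff_dim_convex_hull aff_dim_2)
  qed
  ultimately show ?thesis by (simp add: edge_of_def)
qed

lemma vertex_of_para:
  assumes "cross2 u v \<noteq> 0"
  shows "(c + u + v) extreme_point_of para c u v"
proof -
  have "(c + v + u) extreme_point_of closed_segment (c + v - u) (c + v + u)"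
    by (simp add: extreme_point_of_segment)
  then have "(c + v + u) extreme_point_of para c u v"
    using edge_of_para[OF assms, of c] extreme_point_of_face unfolding edge_of_def by blast
  then show ?thesis by (simp add: add.assoc add.commute[of u v])
qed

lemma extreme_point_of_para_coord:
  assumes "cross2 u v \<noteq> 0" "(c + x *\<^sub>R u + y *\<^sub>R v) extreme_point_of para c u v" "\<bar>x\<bar> \<le> 1" "\<bar>y\<bar> \<le> 1"
  shows "\<bar>x\<bar> = 1"
proof (rule ccontr)
  assume "\<bar>x\<bar> \<noteq> 1"
  then have x: "-1 < x" "x < 1" using assms(3) by auto
  have u: "u \<noteq> 0" using assms(1) by (auto simp: cross2_simps)
  have "c + (-1) *\<^sub>R u + y *\<^sub>R v \<in> para c u v" "c + 1 *\<^sub>R u + y *\<^sub>R v \<in> para c u v"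
    by (rule paraI; use assms(4) in simp)+
  moreover have "c + x *\<^sub>R u + y *\<^sub>R v \<in> open_segment (c + (-1) *\<^sub>R u + y *\<^sub>R v) (c + 1 *\<^sub>R u + y *\<^sub>R v)"
    unfolding in_segment
  proof (intro conjI exI[of _ "(x + 1) / 2"])
    show "c + (-1) *\<^sub>R u + y *\<^sub>R v \<noteq> c + 1 *\<^sub>R u + y *\<^sub>R v"
      using u by (auto simp: plane_eq_iff)
    show "0 < (x + 1) / 2" "(x + 1) / 2 < 1" using x by auto
    show "c + x *\<^sub>R u + y *\<^sub>R v = (1 - (x + 1) / 2) *\<^sub>R (c + (-1) *\<^sub>R u + y *\<^sub>R v)
        + ((x + 1) / 2) *\<^sub>R (c + 1 *\<^sub>R u + y *\<^sub>R v)"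
      by (simp add: plane_eq_iff field_simps)
  qed
  ultimately show False
    using assms(2) unfolding extreme_point_of_def by blast
qed


lemma cross2_decomposeE:
  assumes "cross2 u v \<noteq> 0"
  obtains x y where "p = x *\<^sub>R u + y *\<^sub>R v"
  using cross2_decompose[OF assms, of p] by blast

lemma cross2_both_zero:
  assumes "cross2 u v \<noteq> 0" "cross2 u p = 0" "cross2 p v = 0"
  shows "p = 0"
  using cross2_decompose[OF assms(1), of p] assms(2,3) by simp

lemma extreme_point_of_para:
  assumes uv: "cross2 u v \<noteq> 0" and ext: "p extreme_point_of para c u v"
  obtains x y where "p = c + x *\<^sub>R u + y *\<^sub>R v" "x = 1 \<or> x = -1" "y = 1 \<or> y = -1"
proof -
  have "p \<in> para c u v" using ext by (simp add: extreme_point_of_def)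
  then obtain x y where p: "p = c + x *\<^sub>R u + y *\<^sub>R v" "\<bar>x\<bar> \<le> 1" "\<bar>y\<bar> \<le> 1"
    unfolding para_def by auto
  have "\<bar>x\<bar> = 1" using extreme_point_of_para_coord[OF uv] ext p by blast
  moreover have "\<bar>y\<bar> = 1"
  proof (rule extreme_point_of_para_coord[of v u c y x])
    show "cross2 v u \<noteq> 0" using uv cross2_commute[of u v] by simp
    show "(c + y *\<^sub>R v + x *\<^sub>R u) extreme_point_of para c v u"
      using ext p(1) by (simp add: para_swap add_ac)
  qed (use p in auto)
  ultimately show ?thesis using that[OF p(1)] by linarith
qed

lemma para_reflect: "p \<in> para c u v \<Longrightarrow> c + c - p \<in> para c u v"
proof -
  assume "p \<in> para c u v"
  then obtain x y where p: "p = c + x *\<^sub>R u + y *\<^sub>R v" "\<bar>x\<bar> \<le> 1" "\<bar>y\<bar> \<le> 1"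
    unfolding para_def by auto
  have "c + c - p = c + (- x) *\<^sub>R u + (- y) *\<^sub>R v" by (simp add: p)
  then show ?thesis using paraI[of "- x" "- y"] p by (simp only: abs_minus_cancel)
qed

lemma centre_in_para: "c \<in> para c u v"
  using paraI[of 0 0] by simp

text \<open>The point reflections at both centres preserve the set, so their composition is a
  translation that does. Repeating it leads out of a bounded set unless the translation is
  trivial.\<close>

lemma para_centre_unique:
  assumes uv: "cross2 u v \<noteq> 0" and eq: "para c u v = para c' u' v'"
  shows "c = c'"
proof -
  define d where "d = (c' + c') - (c + c)"
  have step: "p + d \<in> para c u v" if "p \<in> para c u v" for p
    using para_reflect[of "c + c - p" c' u' v'] para_reflect[OF that] eq
    by (simp add: d_def algebra_simps)
  have mem: "c + real n *\<^sub>R d \<in> para c u v" for n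
  proof (induction n)
    case 0
    show ?case by (simp add: centre_in_para)
  next
    case (Suc n)
    then show ?case using step[OF Suc.IH] by (simp add: algebra_simps)
  qed
  have bdd: "z = 0" if "\<And>n::nat. \<bar>real n * z\<bar> \<le> C" for z C :: real
  proof (rule ccontr)
    assume "z \<noteq> 0"
    then obtain n :: nat where "C / \<bar>z\<bar> < real n" using reals_Archimedean2 by blast
    then show False using that[of n] \<open>z \<noteq> 0\<close> by (simp add: abs_mult field_simps)
  qed
  have "cross2 u d = 0" "cross2 d v = 0"
    using mem mem_para_iff[OF uv] by (auto intro!: bdd[of _ "\<bar>cross2 u v\<bar>"] simp: cross2_simps)
  then have "d = 0" using cross2_both_zero[OF uv] by blast
  then show ?thesis by (simp add: d_def plane_eq_iff)
qed

text \<open>Seen from the centre, \<open>u'\<close> and \<open>v'\<close> are half the sum and half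
  the difference of two vertices, whose coordinates in \<open>u\<close> and \<open>v\<close> are 1
  or -1. One coefficient of each vanishes because neither vector is zero.\<close>

lemma para_eqD:
  assumes uv: "cross2 u v \<noteq> 0" and uv': "cross2 u' v' \<noteq> 0" and eq: "para c u v = para c' u' v'"
  shows "(u' = u \<or> u' = - u) \<and> (v' = v \<or> v' = - v) \<or> (u' = v \<or> u' = - v) \<and> (v' = u \<or> v' = - u)"
proof -
  have c: "c' = c" using para_centre_unique[OF uv eq] by simp
  have "(c + u' + v') extreme_point_of para c u v"
    using vertex_of_para[OF uv'] eq c by simp
  then obtain x y where xy: "c + u' + v' = c + x *\<^sub>R u + y *\<^sub>R v" "x = 1 \<or> x = -1" "y = 1 \<or> y = -1"
    using extreme_point_of_para[OF uv] by metis
  have "(c + u' + (- v')) extreme_point_of para c' u' (- v')"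
    unfolding c by (rule vertex_of_para) (use uv' in \<open>simp add: cross2_simps\<close>)
  then have "(c + u' + (- v')) extreme_point_of para c u v"
    using eq by (simp add: para_uminus)
  then obtain x' y' where xy': "c + u' + (- v') = c + x' *\<^sub>R u + y' *\<^sub>R v" "x' = 1 \<or> x' = -1" "y' = 1 \<or> y' = -1"
    using extreme_point_of_para[OF uv] by metis
  have "2 *\<^sub>R u' = (x + x') *\<^sub>R u + (y + y') *\<^sub>R v" "2 *\<^sub>R v' = (x - x') *\<^sub>R u + (y - y') *\<^sub>R v"
    using xy(1) xy'(1) by (auto simp: plane_eq_iff algebra_simps)
  then have "u' = ((x + x') / 2) *\<^sub>R u + ((y + y') / 2) *\<^sub>R v" "v' = ((x - x') / 2) *\<^sub>R u + ((y - y') / 2) *\<^sub>R v"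
    by (auto simp: plane_eq_iff field_simps)
  then show ?thesis
    using uv' xy(2,3) xy'(2,3) by (elim disjE) (auto simp: cross2_simps)
qed

section \<open>Entering the open parallelogram from its boundary\<close>

lemma para_open_subset: "para_open c u v \<subseteq> para c u v"
  unfolding para_open_def para_def using less_imp_le by blast

lemma square_pos: "(z::real) \<noteq> 0 \<Longrightarrow> 0 < z * z"
  using not_real_square_gt_zero[of z] by blast

lemma eventually_at_right_ex: "\<forall>\<^sub>F e in at_right (0::real). P e \<Longrightarrow> \<exists>e. P e"
  using eventually_happens'[OF trivial_limit_at_right_real] .

text \<open>Serves to compare two tiles that meet at a point inside edges of both: a direction that
  is inward for both yields a common point of the open tiles.\<close>

lemma eventually_enters_para_open:
  assumes uv: "cross2 u v \<noteq> 0" and a: "\<bar>a\<bar> < 1" and w: "cross2 u v * cross2 u w < 0"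
  shows "\<forall>\<^sub>F e in at_right 0. c + v + a *\<^sub>R u + e *\<^sub>R w \<in> para_open c u v"
proof -
  let ?D = "cross2 u v"
  have "((\<lambda>e. \<bar>a * ?D + e * cross2 w v\<bar>) \<longlongrightarrow> \<bar>a * ?D + 0 * cross2 w v\<bar>) (at_right 0)"
    by (intro tendsto_intros)
  moreover have "\<bar>a * ?D + 0 * cross2 w v\<bar> < \<bar>?D\<bar>"
    using a uv by (simp add: abs_mult)
  ultimately have 1: "\<forall>\<^sub>F e in at_right 0. \<bar>a * ?D + e * cross2 w v\<bar> < \<bar>?D\<bar>"
    by (rule order_tendstoD)
  have "((\<lambda>e. \<bar>e * cross2 u w\<bar>) \<longlongrightarrow> \<bar>0 * cross2 u w\<bar>) (at_right 0)"
    by (intro tendsto_intros)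
  then have 2: "\<forall>\<^sub>F e in at_right 0. \<bar>e * cross2 u w\<bar> < \<bar>?D\<bar>"
    by (rule order_tendstoD) (use uv in simp)
  have "\<forall>\<^sub>F e::real in at_right 0. e > 0"
    by (simp add: eventually_at_right_less)
  with 1 2 show ?thesis
  proof eventually_elim
    case (elim e)
    have "\<bar>?D + e * cross2 u w\<bar> < \<bar>?D\<bar>"
      using elim(2,3) w by (auto simp: mult_less_0_iff abs_if zero_less_mult_iff split: if_splits)
    moreover have "cross2 (c + v + a *\<^sub>R u + e *\<^sub>R w - c) v = a * ?D + e * cross2 w v"
      "cross2 u (c + v + a *\<^sub>R u + e *\<^sub>R w - c) = ?D + e * cross2 u w"
      by (simp_all add: cross2_simps)
    ultimately show ?case
      using elim(1) by (simp add: mem_para_open_iff[OF uv])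
  qed
qed

lemma para_open_absorb:
  assumes "m \<in> para b x y" "q \<in> para_open b x y" "0 < e" "e \<le> 1"
  shows "m + e *\<^sub>R (q - m) \<in> para_open b x y"
proof -
  obtain s t where m: "m = b + s *\<^sub>R x + t *\<^sub>R y" "\<bar>s\<bar> \<le> 1" "\<bar>t\<bar> \<le> 1"
    using assms(1) unfolding para_def by auto
  obtain s' t' where q: "q = b + s' *\<^sub>R x + t' *\<^sub>R y" "\<bar>s'\<bar> < 1" "\<bar>t'\<bar> < 1"
    using assms(2) unfolding para_open_def by auto
  have *: "\<bar>(1 - e) * r + e * r'\<bar> < 1" if "\<bar>r\<bar> \<le> 1" "\<bar>r'\<bar> < 1" for r r'
  proof -
    have "\<bar>(1 - e) * r + e * r'\<bar> \<le> (1 - e) * \<bar>r\<bar> + e * \<bar>r'\<bar>"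
      using assms(3,4) by (intro order_trans[OF abs_triangle_ineq]) (simp add: abs_mult)
    also have "(1 - e) * \<bar>r\<bar> \<le> (1 - e) * 1" using assms that by (intro mult_left_mono) auto
    also have "e * \<bar>r'\<bar> < e * 1" using assms that by (intro mult_strict_left_mono) auto
    finally show ?thesis by simp
  qed
  have "m + e *\<^sub>R (q - m) = b + ((1 - e) * s + e * s') *\<^sub>R x + ((1 - e) * t + e * t') *\<^sub>R y"
    by (simp add: m q plane_eq_iff algebra_simps)
  then show ?thesis
    using *[OF m(2) q(2)] *[OF m(3) q(3)] unfolding para_open_def by blast
qed

section \<open>Neighbouring tiles\<close>

locale para_tiling =
  fixes \<T> :: "plane set set"
  assumes tiling: "parallelogram_tiling \<T>"
    and locally_finite: "locally_finite_tiling \<T>"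
    and v2v: "vertex_to_vertex \<T>"
begin

lemma tile_para:
  assumes "A \<in> \<T>"
  obtains c u v where "A = para c u v" "cross2 u v \<noteq> 0"
  using assms tiling parallelogram_para unfolding parallelogram_tiling_def by metis

lemma tile_cover: "\<exists>A\<in>\<T>. p \<in> A"
  using tiling unfolding parallelogram_tiling_def by blast

lemma tile_closed: "A \<in> \<T> \<Longrightarrow> closed A"
  using tile_para closed_para by metis

lemma tile_overlap:
  assumes "A \<in> \<T>" "B \<in> \<T>" "p \<in> interior A" "p \<in> B"
  shows "A = B"
proof (rule ccontr)
  assume ne: "A \<noteq> B"
  obtain c u v where B: "B = para c u v" "cross2 u v \<noteq> 0" using tile_para assms(2) by blast
  then obtain q where "q \<in> interior A" "q \<in> para_open c u v"
    using open_meets_para_open[of "interior A" p c u v] assms(3,4) by auto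
  then have "q \<in> interior A \<inter> interior B" using para_open_subset_interior B by blast
  then show False using ne assms tiling unfolding parallelogram_tiling_def by blast
qed

lemma para_overlap:
  assumes "para c u v \<in> \<T>" "cross2 u v \<noteq> 0" "B \<in> \<T>" "p \<in> para_open c u v" "p \<in> B"
  shows "para c u v = B"
  using tile_overlap[OF assms(1,3)] para_open_subset_interior assms by blast

lemma finite_tiles_meeting_bounded:
  assumes "bounded K"
  shows "finite {A \<in> \<T>. A \<inter> K \<noteq> {}}"
proof -
  obtain r where "K \<subseteq> ball 0 r" using assms bounded_subset_ballD by blast
  then have "{A \<in> \<T>. A \<inter> K \<noteq> {}} \<subseteq> {A \<in> \<T>. A \<inter> ball 0 r \<noteq> {}}" by blast
  moreover have "finite {A \<in> \<T>. A \<inter> ball 0 r \<noteq> {}}"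
    using locally_finite unfolding locally_finite_tiling_def by blast
  ultimately show ?thesis by (rule finite_subset)
qed

text \<open>The tiles that meet the unit ball around \<open>m\<close> but miss \<open>m\<close> are
  finitely many closed sets, so their union keeps a positive distance from \<open>m\<close>.\<close>

lemma tiles_near_point:
  obtains e where "e > 0" "\<And>p B. dist m p < e \<Longrightarrow> B \<in> \<T> \<Longrightarrow> p \<in> B \<Longrightarrow> m \<in> B"
proof -
  let ?F = "{B \<in> \<T>. B \<inter> ball m 1 \<noteq> {}}"
  let ?K = "\<Union>{B \<in> ?F. m \<notin> B}"
  have "closed ?K"
    using finite_tiles_meeting_bounded[of "ball m 1"] tile_closed by (intro closed_Union) (auto elim: rev_finite_subset)
  then have "open (- ?K)" by (simp add: open_Compl)
  moreover have "m \<in> - ?K" by auto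
  ultimately obtain d where d: "d > 0" "ball m d \<subseteq> - ?K"
    by (rule openE)
  show ?thesis
  proof (rule that[of "min d 1"])
    fix p B assume "dist m p < min d 1" "B \<in> \<T>" "p \<in> B"
    moreover from this have "p \<in> ball m d" "p \<in> ball m 1" by auto
    ultimately show "m \<in> B" using d(2) by blast
  qed (use d in auto)
qed

lemma vertex_transfer: "A \<in> \<T> \<Longrightarrow> B \<in> \<T> \<Longrightarrow> x extreme_point_of A \<Longrightarrow> x \<in> B \<Longrightarrow> x extreme_point_of B"
  using v2v unfolding vertex_to_vertex_def by blast

text \<open>The midpoint is no vertex of the given tile, so by the vertex condition it is no vertex
  of \<open>B\<close>; nor is it interior to \<open>B\<close>. Changing order and sign of the
  half-sides of \<open>B\<close> brings the edge of \<open>B\<close> that contains it into the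
  stated position.\<close>

lemma edge_midpoint_in_other_tile:
  assumes A: "para c u v \<in> \<T>" and uv: "cross2 u v \<noteq> 0"
    and B: "B \<in> \<T>" "B \<noteq> para c u v" "c + v \<in> B"
  obtains b u1 v1 a where "B = para b u1 v1" "cross2 u1 v1 \<noteq> 0" "c + v = b + v1 + a *\<^sub>R u1" "\<bar>a\<bar> < 1"
proof -
  obtain b x y where xy: "B = para b x y" "cross2 x y \<noteq> 0" using tile_para B by blast
  obtain s t where st: "c + v = b + s *\<^sub>R x + t *\<^sub>R y" "\<bar>s\<bar> \<le> 1" "\<bar>t\<bar> \<le> 1"
    using B(3) unfolding xy para_def by auto
  have mA: "c + v \<in> para c u v" using paraI[of 0 1 c u v] by simp
  have "\<not> (\<bar>s\<bar> < 1 \<and> \<bar>t\<bar> < 1)"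
  proof
    assume "\<bar>s\<bar> < 1 \<and> \<bar>t\<bar> < 1"
    then have "c + v \<in> para_open b x y" unfolding st para_open_def by blast
    then show False using para_overlap[of b x y "para c u v" "c + v"] xy A B mA by auto
  qed
  moreover have "\<not> (\<bar>s\<bar> = 1 \<and> \<bar>t\<bar> = 1)"
  proof
    assume 1: "\<bar>s\<bar> = 1 \<and> \<bar>t\<bar> = 1"
    have "(b + s *\<^sub>R x + t *\<^sub>R y) extreme_point_of para b (s *\<^sub>R x) (t *\<^sub>R y)"
      by (rule vertex_of_para) (use 1 xy in \<open>auto simp: cross2_simps\<close>)
    moreover have "para b (s *\<^sub>R x) (t *\<^sub>R y) = B"
      using 1 by (auto simp: xy para_uminus abs_if split: if_splits)
    ultimately have "(c + v) extreme_point_of para c u v"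
      using vertex_transfer[OF B(1) A _ mA] st by simp
    then have "(c + 0 *\<^sub>R u + 1 *\<^sub>R v) extreme_point_of para c u v" by simp
    from extreme_point_of_para_coord[OF uv this] show False by simp
  qed
  ultimately consider "\<bar>t\<bar> = 1" "\<bar>s\<bar> < 1" | "\<bar>s\<bar> = 1" "\<bar>t\<bar> < 1" using st by linarith
  then show ?thesis
  proof cases
    case 1
    then consider "t = 1" | "t = -1" by linarith
    then show ?thesis
    proof cases
      case sign: 1
      show ?thesis by (rule that[of b x y s]) (use xy st 1 sign in \<open>simp_all add: add_ac\<close>)
    next
      case sign: 2
      show ?thesis by (rule that[of b x "- y" s]) (use xy st 1 sign in \<open>simp_all add: para_uminus cross2_simps algebra_simps\<close>)
    qed
  next
    case 2
    have yx: "cross2 y x \<noteq> 0" using xy cross2_commute[of x y] by simp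
    from 2 consider "s = 1" | "s = -1" by linarith
    then show ?thesis
    proof cases
      case sign: 1
      show ?thesis by (rule that[of b y x t]) (use yx xy st 2 sign in \<open>simp_all add: para_swap add_ac\<close>)
    next
      case sign: 2
      show ?thesis by (rule that[of b y "- x" t]) (use yx xy st 2 sign in \<open>simp_all add: para_uminus para_swap cross2_simps algebra_simps\<close>)
    qed
  qed
qed

text \<open>Since no vertex of either tile lies in the relative interior of an edge of the other, two
  edges with a common relatively interior point coincide.\<close>

lemma neighbour_exists:
  assumes A: "para c u v \<in> \<T>" and uv: "cross2 u v \<noteq> 0"
  obtains v' where "para (c + v + v') u v' \<in> \<T>" "cross2 u v * cross2 u v' > 0"
proof -
  define m where "m = c + v"
  define D where "D = cross2 u v"
  have v0: "v \<noteq> 0" and D0: "D \<noteq> 0" using uv by (auto simp: cross2_simps D_def)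
  obtain e where e: "e > 0" "\<And>p B. dist m p < e \<Longrightarrow> B \<in> \<T> \<Longrightarrow> p \<in> B \<Longrightarrow> m \<in> B"
    using tiles_near_point by blast
  \<comment> \<open>A point slightly beyond the edge: the tile \<open>B\<close> covering it cannot
    be the given one, and by the choice of \<open>e\<close> it also contains
    \<open>m\<close>.\<close>
  define s where "s = e / (2 * norm v)"
  have s: "s > 0" "dist m (m + s *\<^sub>R v) < e"
    using e(1) v0 by (simp_all add: s_def dist_norm)
  obtain B where B: "B \<in> \<T>" "m + s *\<^sub>R v \<in> B" using tile_cover by blast
  then have mB: "m \<in> B" using e s by blast
  have "m + s *\<^sub>R v \<notin> para c u v"
  proof -
    have "cross2 u (m + s *\<^sub>R v - c) = (1 + s) * cross2 u v"
      by (simp add: m_def cross2_simps algebra_simps)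
    moreover have "(1 + s) * \<bar>cross2 u v\<bar> > 1 * \<bar>cross2 u v\<bar>"
      using s(1) uv by (intro mult_strict_right_mono) auto
    ultimately show ?thesis using s(1) by (simp add: mem_para_iff[OF uv] abs_mult)
  qed
  then have ne: "B \<noteq> para c u v" using B by blast
  obtain b u1 v1 a where B1: "B = para b u1 v1" "cross2 u1 v1 \<noteq> 0" "m = b + v1 + a *\<^sub>R u1" "\<bar>a\<bar> < 1"
    using edge_midpoint_in_other_tile[OF A uv B(1) ne mB[unfolded m_def]] unfolding m_def by blast
  have par: "cross2 u u1 = 0"
  proof (rule ccontr)
    assume k: "cross2 u u1 \<noteq> 0"
    \<comment> \<open>If the edges crossed at \<open>m\<close>, some direction would point into both
      tiles; \<open>w\<close> has the determinants \<open>- D\<close> and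
      \<open>- cross2 u1 v1\<close> against the two edge directions.\<close>
    define w where "w = (cross2 u1 v1 / cross2 u u1) *\<^sub>R u - (D / cross2 u u1) *\<^sub>R u1"
    have w: "cross2 u w = - D" "cross2 u1 w = - cross2 u1 v1"
      using k by (simp_all add: w_def cross2_simps) (simp add: cross2_commute[of u1 u])
    have "\<forall>\<^sub>F e in at_right 0. c + v + 0 *\<^sub>R u + e *\<^sub>R w \<in> para_open c u v"
      by (rule eventually_enters_para_open[OF uv]) (use D0 w in \<open>simp_all add: D_def[symmetric] square_pos\<close>)
    moreover have "\<forall>\<^sub>F e in at_right 0. b + v1 + a *\<^sub>R u1 + e *\<^sub>R w \<in> para_open b u1 v1"
      by (rule eventually_enters_para_open[OF B1(2,4)]) (use B1 w in \<open>simp add: square_pos\<close>)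
    ultimately have "\<forall>\<^sub>F e in at_right 0. m + e *\<^sub>R w \<in> para_open c u v \<and> m + e *\<^sub>R w \<in> para_open b u1 v1"
      by eventually_elim (use B1(3) in \<open>auto simp: m_def\<close>)
    then obtain e where "m + e *\<^sub>R w \<in> para_open c u v" "m + e *\<^sub>R w \<in> para_open b u1 v1"
      using eventually_at_right_ex by blast
    then have "para c u v = B"
      using para_overlap[OF A uv B(1)] para_open_subset_interior[OF B1(2)] interior_subset B1(1) by blast
    then show False using ne by simp
  qed
  have u0: "u \<noteq> 0" using uv by (auto simp: cross2_simps)
  obtain x y where "u1 = x *\<^sub>R u + y *\<^sub>R v" using cross2_decomposeE[OF uv] .
  moreover from this par uv have "y = 0" by (simp add: cross2_simps)
  ultimately have k1: "u1 = x *\<^sub>R u" by simp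
  obtain b u1 v1 a k where B1: "B = para b u1 v1" "cross2 u1 v1 \<noteq> 0" "m = b + v1 + a *\<^sub>R u1" "\<bar>a\<bar> < 1"
    and k: "u1 = k *\<^sub>R u" "k > 0"
  proof (cases "x > 0")
    case True
    then show ?thesis using that[OF B1 k1] by blast
  next
    case False
    have "x \<noteq> 0" using B1(2) k1 by (auto simp: cross2_simps)
    then show ?thesis
      using that[of b "- u1" v1 "- a" "- x"] B1 k1 False by (simp add: para_uminus cross2_simps)
  qed
  define D1 where "D1 = cross2 u v1"
  have D10: "D1 \<noteq> 0" using B1(2) k by (simp add: cross2_simps D1_def)
  \<comment> \<open>\<open>B\<close> contains a point beyond the edge, so its inward direction
    \<open>- v1\<close> lies on the same side of \<open>u\<close> as \<open>v\<close>.\<close>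
  have opp: "D * D1 < 0"
  proof -
    have "\<bar>cross2 u1 (m + s *\<^sub>R v - b)\<bar> \<le> \<bar>cross2 u1 v1\<bar>"
      using B(2) by (simp add: B1(1) mem_para_iff[OF B1(2)])
    moreover have "cross2 u1 (m + s *\<^sub>R v - b) = k * (D1 + s * D)"
      by (simp add: B1(3) k D_def D1_def cross2_simps algebra_simps)
    moreover have "cross2 u1 v1 = k * D1" by (simp add: k D1_def cross2_simps)
    ultimately have "\<bar>D1 + s * D\<bar> \<le> \<bar>D1\<bar>" using k(2) by (simp add: abs_mult)
    moreover have "s * D > 0 \<longleftrightarrow> D > 0" "s * D < 0 \<longleftrightarrow> D < 0"
      using s by (simp_all add: zero_less_mult_iff mult_less_0_iff)
    ultimately show ?thesis using D0 D10 by (auto simp: mult_less_0_iff abs_if split: if_splits)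
  qed
  \<comment> \<open>An end \<open>z\<close> of the edge of \<open>B\<close> has the coordinate
    \<open>k * (z - a)\<close> on the edge of the given tile. If it lies on that edge, it is a
    vertex there too.\<close>
  have vA: "\<bar>k * (z - a)\<bar> = 1" if z: "z = 1 \<or> z = -1" and le: "\<bar>k * (z - a)\<bar> \<le> 1" for z
  proof -
    have "(b + z *\<^sub>R u1 + v1) extreme_point_of para b (z *\<^sub>R u1) v1"
      by (rule vertex_of_para) (use z B1 in \<open>auto simp: cross2_simps\<close>)
    moreover have "para b (z *\<^sub>R u1) v1 = B" using z by (auto simp: B1 para_uminus)
    moreover have eq: "b + z *\<^sub>R u1 + v1 = c + (k * (z - a)) *\<^sub>R u + 1 *\<^sub>R v"
      using B1(3) unfolding m_def k(1) by (simp add: plane_eq_iff algebra_simps)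
    ultimately have "(c + (k * (z - a)) *\<^sub>R u + 1 *\<^sub>R v) extreme_point_of B" by simp
    moreover have "c + (k * (z - a)) *\<^sub>R u + 1 *\<^sub>R v \<in> para c u v"
      by (rule paraI) (use le in simp_all)
    ultimately have "(c + (k * (z - a)) *\<^sub>R u + 1 *\<^sub>R v) extreme_point_of para c u v"
      using vertex_transfer[OF B(1) A] by blast
    then show ?thesis using extreme_point_of_para_coord[OF uv, where y = 1] le by simp
  qed
  have vB: "\<bar>z / k + a\<bar> = 1" if z: "z = 1 \<or> z = -1" and le: "\<bar>z / k + a\<bar> \<le> 1" for z
  proof -
    have "(c + z *\<^sub>R u + v) extreme_point_of para c (z *\<^sub>R u) v"
      by (rule vertex_of_para) (use z uv in \<open>auto simp: cross2_simps\<close>)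
    moreover have "para c (z *\<^sub>R u) v = para c u v" using z by (auto simp: para_uminus)
    moreover have eq: "c + z *\<^sub>R u + v = b + (z / k + a) *\<^sub>R u1 + 1 *\<^sub>R v1"
    proof -
      have zu: "z *\<^sub>R u = (z / k) *\<^sub>R u1" using k by simp
      have "c + z *\<^sub>R u + v = (c + v) + z *\<^sub>R u" by simp
      also have "\<dots> = (b + v1 + a *\<^sub>R u1) + (z / k) *\<^sub>R u1"
        unfolding zu using B1(3) by (simp add: m_def)
      also have "\<dots> = b + (z / k + a) *\<^sub>R u1 + 1 *\<^sub>R v1"
        by (simp add: scaleR_left.add)
      finally show ?thesis .
    qed
    ultimately have "(b + (z / k + a) *\<^sub>R u1 + 1 *\<^sub>R v1) extreme_point_of para c u v" by simp
    moreover have "b + (z / k + a) *\<^sub>R u1 + 1 *\<^sub>R v1 \<in> para b u1 v1"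
      by (rule paraI) (use le in simp_all)
    ultimately have "(b + (z / k + a) *\<^sub>R u1 + 1 *\<^sub>R v1) extreme_point_of para b u1 v1"
      using vertex_transfer[OF A B(1)] B1(1) by blast
    then show ?thesis using extreme_point_of_para_coord[OF B1(2), where y = 1] le by simp
  qed
  \<comment> \<open>If these ends differed, one of them would lie strictly inside the other edge:
    \<open>vA\<close> excludes this for the end of \<open>B\<close>, \<open>vB\<close> for the end
    of the given tile. With the same argument at the other ends, \<open>a = 0\<close> and
    \<open>k = 1\<close>.\<close>
  have 1: "k * (1 - a) = 1"
  proof (rule ccontr)
    assume "k * (1 - a) \<noteq> 1"
    then consider "k * (1 - a) < 1" | "k * (1 - a) > 1" by linarith
    then show False
    proof cases
      case 1
      moreover have "k * (1 - a) > 0" using k B1(4) by simp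
      ultimately show False using vA[of 1] by simp
    next
      case 2
      then have "1 / k + a < 1" using k by (simp add: field_simps)
      moreover have "1 / k > 0" using k by simp
      ultimately show False using vB[of 1] B1(4) by linarith
    qed
  qed
  have 2: "k * (1 + a) = 1"
  proof (rule ccontr)
    assume "k * (1 + a) \<noteq> 1"
    then consider "k * (1 + a) < 1" | "k * (1 + a) > 1" by linarith
    then show False
    proof cases
      case 1
      moreover have "k * (1 + a) > 0" using k B1(4) by simp
      moreover have "k * (- 1 - a) = - (k * (1 + a))" by (simp add: algebra_simps)
      ultimately show False using vA[of "-1"] by simp
    next
      case 2
      then have "-1 / k + a > -1" using k by (simp add: field_simps)
      moreover have "1 / k > 0" using k by simp
      ultimately show False using vB[of "-1"] B1(4) by linarith
    qed
  qed
  have "k * (1 - a) = k * (1 + a)" using 1 2 by simp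
  then have a0: "a = 0" using k(2) by simp
  moreover have k1: "k = 1" using 1 unfolding a0 by simp
  ultimately have "B = para (c + v + (- v1)) u (- v1)"
    using B1(1,3) k(1) by (simp add: para_uminus m_def)
  moreover have "cross2 u v * cross2 u (- v1) > 0"
    using opp by (simp add: D_def D1_def cross2_simps)
  ultimately show ?thesis using that B(1) by blast
qed

text \<open>The points \<open>m + e v1\<close> with small \<open>e\<close> lie in both open tiles,
  so the tiles coincide, and a tile determines its centre.\<close>

lemma neighbour_unique:
  assumes 1: "para (m + v1) u v1 \<in> \<T>" and 2: "para (m + v2) u v2 \<in> \<T>"
    and pos: "cross2 u v1 * cross2 u v2 > 0"
  shows "v1 = v2"
proof -
  have n: "cross2 u v1 \<noteq> 0" "cross2 u v2 \<noteq> 0" using pos by auto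
  have n': "cross2 u (- v1) \<noteq> 0" "cross2 u (- v2) \<noteq> 0" using n by (simp_all add: cross2_simps)
  have "\<forall>\<^sub>F e in at_right 0. (m + v1) + (- v1) + 0 *\<^sub>R u + e *\<^sub>R v1 \<in> para_open (m + v1) u (- v1)"
    by (rule eventually_enters_para_open[OF n'(1)]) (use n in \<open>simp_all add: cross2_simps square_pos\<close>)
  moreover have "\<forall>\<^sub>F e in at_right 0. (m + v2) + (- v2) + 0 *\<^sub>R u + e *\<^sub>R v1 \<in> para_open (m + v2) u (- v2)"
    by (rule eventually_enters_para_open[OF n'(2)]) (use pos in \<open>auto simp: cross2_simps mult_less_0_iff zero_less_mult_iff\<close>)
  ultimately have "\<forall>\<^sub>F e in at_right 0. m + e *\<^sub>R v1 \<in> para_open (m + v1) u (- v1) \<and> m + e *\<^sub>R v1 \<in> para_open (m + v2) u (- v2)"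
    by eventually_elim simp
  then obtain e where "m + e *\<^sub>R v1 \<in> para_open (m + v1) u (- v1)" "m + e *\<^sub>R v1 \<in> para_open (m + v2) u (- v2)"
    using eventually_at_right_ex by blast
  then have "para (m + v1) u (- v1) = para (m + v2) u (- v2)"
    using para_overlap[of "m + v1" u "- v1" "para (m + v2) u (- v2)"] 1 2 n'
      para_open_subset[of "m + v2" u "- v2"] by (simp add: para_uminus subset_iff)
  from para_centre_unique[OF n'(1) this] show ?thesis by simp
qed

text \<open>\<open>B\<close> is nondegenerate, so it has an interior point \<open>q\<close> off the
  line of the edge. The way from the midpoint to \<open>q\<close> runs inside \<open>B\<close> and
  begins in one of the two given tiles, which therefore overlaps \<open>B\<close>.\<close>

lemma tile_at_edge_midpoint:
  assumes A: "para c u v \<in> \<T>" and A': "para (c + v + v') u v' \<in> \<T>"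
    and pos: "cross2 u v * cross2 u v' > 0" and B: "B \<in> \<T>" "c + v \<in> B"
  shows "B = para c u v \<or> B = para (c + v + v') u v'"
proof -
  define m where "m = c + v"
  have n: "cross2 u v \<noteq> 0" "cross2 u v' \<noteq> 0" using pos by auto
  have n': "cross2 u (- v') \<noteq> 0" using n by (simp add: cross2_simps)
  obtain b x y where xy: "B = para b x y" "cross2 x y \<noteq> 0" using tile_para B by blast
  obtain q where q: "q \<in> para_open b x y" "cross2 u (q - m) \<noteq> 0"
  proof (cases "cross2 u (b - m) = 0")
    case False
    moreover have "b + 0 *\<^sub>R x + 0 *\<^sub>R y \<in> para_open b x y" by (auto simp: para_open_def intro!: exI[of _ "0::real"])
    ultimately show ?thesis using that by simp
  next
    case True
    have "b + (1/2) *\<^sub>R x + 0 *\<^sub>R y \<in> para_open b x y" "b + 0 *\<^sub>R x + (1/2) *\<^sub>R y \<in> para_open b x y"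
      unfolding para_open_def by (intro CollectI exI[of _ "1/2"] exI[of _ "0::real"]; simp)+
    moreover have "cross2 u x \<noteq> 0 \<or> cross2 u y \<noteq> 0"
    proof (rule ccontr)
      assume "\<not> ?thesis"
      moreover obtain s t where "v = s *\<^sub>R x + t *\<^sub>R y" using cross2_decomposeE[OF xy(2)] .
      ultimately show False using n by (simp add: cross2_simps)
    qed
    ultimately show ?thesis
      using that[of "b + (1/2) *\<^sub>R x"] that[of "b + (1/2) *\<^sub>R y"] True by (auto simp: cross2_simps)
  qed
  define w where "w = q - m"
  have inB: "\<forall>\<^sub>F e in at_right 0. m + e *\<^sub>R w \<in> para_open b x y"
  proof -
    have "\<forall>\<^sub>F e::real in at_right 0. e \<in> {0<..<1}" by (rule eventually_at_right_real) simp
    then show ?thesis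
      by eventually_elim (use para_open_absorb[of m b x y q] B(2) q(1) xy(1) in \<open>auto simp: m_def w_def\<close>)
  qed
  have hit: "B = P" if P: "P \<in> \<T>" and ev: "\<forall>\<^sub>F e in at_right 0. m + e *\<^sub>R w \<in> P" for P
  proof -
    from inB ev have "\<forall>\<^sub>F e in at_right 0. m + e *\<^sub>R w \<in> para_open b x y \<and> m + e *\<^sub>R w \<in> P"
      by eventually_elim simp
    then obtain e where "m + e *\<^sub>R w \<in> para_open b x y" "m + e *\<^sub>R w \<in> P"
      using eventually_at_right_ex by blast
    then show ?thesis using para_overlap[of b x y P] B(1) xy P by blast
  qed
  consider "cross2 u v * cross2 u w < 0" | "cross2 u v * cross2 u w > 0"
    using q(2) n unfolding w_def by (metis linorder_neqE_linordered_idom mult_eq_0_iff)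
  then show ?thesis
  proof cases
    case 1
    have "\<forall>\<^sub>F e in at_right 0. c + v + 0 *\<^sub>R u + e *\<^sub>R w \<in> para_open c u v"
      by (rule eventually_enters_para_open[OF n(1)]) (use 1 in auto)
    then have "\<forall>\<^sub>F e in at_right 0. m + e *\<^sub>R w \<in> para c u v"
      by eventually_elim (use para_open_subset in \<open>auto simp: m_def\<close>)
    then show ?thesis using hit[OF A] by blast
  next
    case 2
    have "\<forall>\<^sub>F e in at_right 0. (c + v + v') + (- v') + 0 *\<^sub>R u + e *\<^sub>R w \<in> para_open (c + v + v') u (- v')"
      by (rule eventually_enters_para_open[OF n'])
        (use 2 pos in \<open>auto simp: cross2_simps zero_less_mult_iff\<close>)
    then have "\<forall>\<^sub>F e in at_right 0. m + e *\<^sub>R w \<in> para (c + v + v') u v'"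
      by eventually_elim (use para_open_subset[of _ u "- v'"] in \<open>auto simp: m_def para_uminus subset_iff\<close>)
    then show ?thesis using hit[OF A'] by blast
  qed
qed

end


section \<open>Lipschitz graphs and worms\<close>

lemma cross2_zero_parallel:
  assumes "u \<noteq> 0" "cross2 u w = 0"
  obtains s where "w = s *\<^sub>R u"
proof -
  have "u $ 1 \<noteq> 0 \<or> u $ 2 \<noteq> 0" using assms(1) by (auto simp: plane_eq_iff)
  then show ?thesis
  proof
    assume "u $ 1 \<noteq> 0"
    then show ?thesis using assms(2) by (intro that[of "w $ 1 / u $ 1"]) (auto simp: plane_eq_iff cross2_def field_simps)
  next
    assume "u $ 2 \<noteq> 0"
    then show ?thesis using assms(2) by (intro that[of "w $ 2 / u $ 2"]) (auto simp: plane_eq_iff cross2_def field_simps)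
  qed
qed

lemma connected_nonzero_pos:
  fixes f :: "'a::topological_space \<Rightarrow> real"
  assumes "connected S" "continuous_on S f" "\<And>x. x \<in> S \<Longrightarrow> f x \<noteq> 0" "a \<in> S" "f a > 0" "x \<in> S"
  shows "f x > 0"
proof (rule ccontr)
  assume "\<not> f x > 0"
  moreover have "connected (f ` S)" using assms(1,2) by (rule connected_continuous_image[rotated])
  ultimately have "{f x..f a} \<subseteq> f ` S"
    using assms(4,6) by (intro connected_contains_Icc) auto
  moreover have "0 \<in> {f x..f a}" using \<open>\<not> f x > 0\<close> assms(5) by simp
  ultimately show False using assms(3) by force
qed

text \<open>\<open>C\<close> is a graph over the direction orthogonal to \<open>u\<close>: \<open>cross2 u\<close> is the coordinate on the
  base line, up to the factor \<open>norm u\<close>.\<close>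

definition line_graph :: "real \<Rightarrow> plane \<Rightarrow> plane set \<Rightarrow> bool" where
  "line_graph k u C \<longleftrightarrow>
     (\<forall>p\<in>C. \<forall>q\<in>C. \<bar>u \<bullet> (q - p)\<bar> \<le> k * \<bar>cross2 u (q - p)\<bar>) \<and> (\<forall>h. \<exists>p\<in>C. cross2 u p = h)"

text \<open>Signed distance from \<open>C\<close> in the direction of \<open>u\<close>, in units of \<open>norm u\<close>.\<close>

definition offset :: "plane \<Rightarrow> plane set \<Rightarrow> plane \<Rightarrow> real" where
  "offset u C p = (THE s. p - s *\<^sub>R u \<in> C)"

context
  fixes k u C
  assumes graph: "line_graph k u C"
begin

lemma graph_dir_nonzero: "u \<noteq> 0"
proof
  assume "u = 0"
  moreover obtain p where "cross2 u p = 1" using graph unfolding line_graph_def by blast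
  ultimately show False by (simp add: cross2_simps)
qed

lemma graph_cone: "p \<in> C \<Longrightarrow> q \<in> C \<Longrightarrow> \<bar>u \<bullet> (q - p)\<bar> \<le> k * \<bar>cross2 u (q - p)\<bar>"
  using graph unfolding line_graph_def by blast

lemma graph_slope_nonneg: "k \<ge> 0"
proof -
  obtain p q where "p \<in> C" "q \<in> C" "cross2 u p = 0" "cross2 u q = 1"
    using graph unfolding line_graph_def by blast
  then have "\<bar>u \<bullet> (q - p)\<bar> \<le> k" using graph_cone[of p q] by (simp add: cross2_simps)
  then show ?thesis using abs_ge_zero order_trans by blast
qed

lemma offset_eq: "p - s *\<^sub>R u \<in> C \<Longrightarrow> offset u C p = s"
  unfolding offset_def
proof (rule the_equality)
  fix r assume 1: "p - s *\<^sub>R u \<in> C" "p - r *\<^sub>R u \<in> C"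
  have "(p - s *\<^sub>R u) - (p - r *\<^sub>R u) = (r - s) *\<^sub>R u" by (simp add: algebra_simps)
  then have "\<bar>u \<bullet> ((r - s) *\<^sub>R u)\<bar> \<le> k * \<bar>cross2 u ((r - s) *\<^sub>R u)\<bar>"
    using graph_cone[OF 1(2,1)] by simp
  then show "r = s" using graph_dir_nonzero by (simp add: cross2_simps)
qed

lemma offset_mem: "p - offset u C p *\<^sub>R u \<in> C"
proof -
  obtain q where q: "q \<in> C" "cross2 u q = cross2 u p"
    using graph unfolding line_graph_def by blast
  then have "cross2 u (p - q) = 0" by (simp add: cross2_simps)
  then obtain s where "p - q = s *\<^sub>R u" using cross2_zero_parallel graph_dir_nonzero by blast
  then have "p - s *\<^sub>R u = q" by (simp add: algebra_simps)
  then show ?thesis using offset_eq q by metis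
qed

lemma offset_shift: "offset u C (p + r *\<^sub>R u) = offset u C p + r"
  by (rule offset_eq) (use offset_mem[of p] in \<open>simp add: algebra_simps\<close>)

lemma offset_shift': "offset u C (p - r *\<^sub>R u) = offset u C p - r"
  using offset_shift[of p "- r"] by simp

lemma offset_zero_iff: "offset u C p = 0 \<longleftrightarrow> p \<in> C"
  using offset_mem[of p] offset_eq[of p 0] by auto

text \<open>Moving along \<open>u\<close> does not change \<open>cross2 u\<close>, so the difference
  of the feet of \<open>p\<close> and \<open>q\<close> on \<open>C\<close> has the same determinant
  as \<open>p - q\<close>; the slope bound then controls its component along
  \<open>u\<close>.\<close>

lemma offset_lipschitz: "((1 + k) / norm u)-lipschitz_on S (offset u C)"
proof (rule lipschitz_onI)
  have u: "norm u > 0" using graph_dir_nonzero by simp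
  show "0 \<le> (1 + k) / norm u" using graph_slope_nonneg by simp
  fix p q
  let ?s = "offset u C p" and ?t = "offset u C q"
  define a where "a = (p - ?s *\<^sub>R u) - (q - ?t *\<^sub>R u)"
  have "\<bar>u \<bullet> a\<bar> \<le> k * \<bar>cross2 u a\<bar>"
    unfolding a_def by (intro graph_cone offset_mem)
  also have "cross2 u a = cross2 u (p - q)" by (simp add: a_def cross2_simps)
  also have "k * \<bar>cross2 u (p - q)\<bar> \<le> k * (norm u * norm (p - q))"
    using graph_slope_nonneg cross2_le by (intro mult_left_mono) auto
  finally have 1: "\<bar>u \<bullet> a\<bar> \<le> k * (norm u * norm (p - q))" .
  have "(?s - ?t) * (norm u * norm u) = u \<bullet> (p - q) - u \<bullet> a"
    by (simp add: a_def inner_diff_right power2_norm_eq_inner[symmetric] power2_eq_square algebra_simps)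
  then have "\<bar>?s - ?t\<bar> * (norm u * norm u) = \<bar>u \<bullet> (p - q) - u \<bullet> a\<bar>"
    by (metis abs_mult abs_mult_self_eq abs_norm_cancel)
  also have "\<dots> \<le> norm u * norm (p - q) + k * (norm u * norm (p - q))"
    using 1 Cauchy_Schwarz_ineq2[of u "p - q"] by linarith
  finally have "\<bar>?s - ?t\<bar> * norm u * norm u \<le> (1 + k) * norm (p - q) * norm u"
    by (simp add: algebra_simps)
  then have "\<bar>?s - ?t\<bar> * norm u \<le> (1 + k) * norm (p - q)"
    using u by simp
  then show "dist ?s ?t \<le> (1 + k) / norm u * dist p q"
    using u by (simp add: dist_norm field_simps)
qed

lemma continuous_on_offset: "continuous_on S (offset u C)"
  using offset_lipschitz by (rule lipschitz_on_continuous_on)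

text \<open>The projection along \<open>u\<close> maps the connected plane continuously onto
  \<open>C\<close>.\<close>

lemma connected_graph: "connected C"
proof -
  have "C = (\<lambda>p. p - offset u C p *\<^sub>R u) ` UNIV"
  proof
    show "C \<subseteq> (\<lambda>p. p - offset u C p *\<^sub>R u) ` UNIV"
    proof
      fix p assume "p \<in> C"
      then have "p = p - offset u C p *\<^sub>R u" using offset_zero_iff[of p] by simp
      then show "p \<in> (\<lambda>p. p - offset u C p *\<^sub>R u) ` UNIV" by blast
    qed
  qed (use offset_mem in blast)
  moreover have "connected ((\<lambda>p. p - offset u C p *\<^sub>R u) ` UNIV)"
    by (intro connected_continuous_image continuous_intros continuous_on_offset connected_UNIV)
  ultimately show ?thesis by simp
qed

lemma offset_pos_on_connected:
  assumes "connected S" "S \<inter> C = {}" "a \<in> S" "offset u C a > 0" "x \<in> S"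
  shows "offset u C x > 0"
  by (rule connected_nonzero_pos[OF assms(1) continuous_on_offset _ assms(3-5)])
    (use assms(2) offset_zero_iff in blast)

lemma offset_uminus: "offset (- u) C p = - offset u C p"
proof -
  have "offset u C p = - s" if "p - s *\<^sub>R (- u) \<in> C" for s
    by (rule offset_eq) (use that in simp)
  then show ?thesis
    unfolding offset_def[of "- u"] using offset_mem[of p]
    by (intro the_equality) auto
qed

end

text \<open>The tiles \<open>para (c i) u (v i)\<close> form a worm whose shared edges are the translates
  \<open>c i + v i + [- u, u]\<close>; the sign \<open>\<sigma>\<close> records on which side of \<open>u\<close> the worm proceeds.\<close>

definition worm_data :: "plane set set \<Rightarrow> real \<Rightarrow> plane \<Rightarrow> (int \<Rightarrow> plane) \<Rightarrow> (int \<Rightarrow> plane) \<Rightarrow> bool" where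
  "worm_data \<T> \<sigma> u c v \<longleftrightarrow>
     (\<forall>i. para (c i) u (v i) \<in> \<T> \<and> \<sigma> * cross2 u (v i) > 0 \<and> c (i + 1) = c i + v i + v (i + 1))"

text \<open>For a worm this is a broken line through the centres and the midpoints of the shared
  edges; its pieces join because \<open>c i + v i = c (i + 1) - v (i + 1)\<close>.\<close>

definition axis :: "(int \<Rightarrow> plane) \<Rightarrow> (int \<Rightarrow> plane) \<Rightarrow> plane set" where
  "axis c v = {c i + s *\<^sub>R v i | i s. \<bar>s\<bar> \<le> 1}"

definition worm_tiles :: "plane \<Rightarrow> (int \<Rightarrow> plane) \<Rightarrow> (int \<Rightarrow> plane) \<Rightarrow> plane set set" where
  "worm_tiles u c v = range (\<lambda>i. para (c i) u (v i))"

lemma axisI: "\<bar>s\<bar> \<le> 1 \<Longrightarrow> c i + s *\<^sub>R v i \<in> axis c v"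
  unfolding axis_def by blast

lemma centre_in_axis: "c i \<in> axis c v"
  using axisI[of 0 c i v] by simp

lemma worm_dataD:
  assumes "worm_data \<T> \<sigma> u c v"
  shows "para (c i) u (v i) \<in> \<T>" "\<sigma> * cross2 u (v i) > 0" "c (i + 1) = c i + v i + v (i + 1)"
    "cross2 u (v i) \<noteq> 0" "cross2 u (v i) * cross2 u (v j) > 0"
proof -
  have "\<sigma> * cross2 u (v j) > 0" for j
    using assms unfolding worm_data_def by blast
  from this[of i] this[of j] show "cross2 u (v i) \<noteq> 0" "cross2 u (v i) * cross2 u (v j) > 0"
    by (auto simp: zero_less_mult_iff)
qed (use assms in \<open>auto simp: worm_data_def\<close>)

lemma worm_data_flip: "worm_data \<T> \<sigma> u c v \<Longrightarrow> worm_data \<T> (- \<sigma>) (- u) c v"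
  unfolding worm_data_def by (simp add: para_uminus cross2_simps)

lemma worm_data_reverse:
  assumes "worm_data \<T> \<sigma> u c v"
  shows "worm_data \<T> (- \<sigma>) u (\<lambda>i. c (- i)) (\<lambda>i. - v (- i))"
proof -
  have "c (- (i + 1)) = c (- i) - v (- i) - v (- (i + 1))" for i
    using worm_dataD(3)[OF assms, of "- (i + 1)"] by (simp add: algebra_simps)
  then show ?thesis
    using assms unfolding worm_data_def by (simp add: para_uminus cross2_simps)
qed

lemma axis_reverse: "axis (\<lambda>i. c (- i)) (\<lambda>i. - v (- i)) = axis c v"
proof -
  have sub: "axis (\<lambda>i. c (- i)) (\<lambda>i. - v (- i)) \<subseteq> axis c v" for c v :: "int \<Rightarrow> plane"
  proof
    fix p assume "p \<in> axis (\<lambda>i. c (- i)) (\<lambda>i. - v (- i))"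
    then obtain i s where "p = c (- i) + (- s) *\<^sub>R v (- i)" "\<bar>- s\<bar> \<le> 1" unfolding axis_def by auto
    then show "p \<in> axis c v" using axisI by blast
  qed
  from sub[of c v] sub[of "\<lambda>i. c (- i)" "\<lambda>i. - v (- i)"] show ?thesis by simp
qed

lemma worm_tiles_reverse: "worm_tiles u (\<lambda>i. c (- i)) (\<lambda>i. - v (- i)) = worm_tiles u c v"
proof -
  have "worm_tiles u (\<lambda>i. c (- i)) (\<lambda>i. - v (- i)) = range ((\<lambda>i. para (c i) u (v i)) \<circ> uminus)"
    unfolding worm_tiles_def by (simp add: para_uminus comp_def)
  also have "\<dots> = worm_tiles u c v"
    unfolding worm_tiles_def image_comp[symmetric] by (simp add: surj_uminus)
  finally show ?thesis .
qed

lemma worm_tiles_uminus: "worm_tiles (- u) c v = worm_tiles u c v"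
  unfolding worm_tiles_def by (simp add: para_uminus)

text \<open>Reversing the indices and negating \<open>u\<close> each flip the sign, so all four
  combinations arise from the same worm. This later allows one common \<open>\<sigma>\<close> with
  freely chosen directions of \<open>u\<close> and \<open>y\<close>.\<close>

lemma worm_data_orient:
  assumes "worm_data \<T> \<sigma> u c v" "\<sigma> = 1 \<or> \<sigma> = -1" "\<tau> = 1 \<or> \<tau> = -1" "u' = u \<or> u' = - u"
  obtains c' v' where "worm_data \<T> \<tau> u' c' v'" "axis c' v' = axis c v" "worm_tiles u' c' v' = worm_tiles u c v"
proof -
  note r = worm_data_reverse[OF assms(1)]
  note f = worm_data_flip[OF assms(1)] worm_data_flip[OF r]
  consider "u' = u" "\<tau> = \<sigma>" | "u' = u" "\<tau> = - \<sigma>" | "u' = - u" "\<tau> = - \<sigma>" | "u' = - u" "\<tau> = \<sigma>"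
    using assms by force
  then show ?thesis
  proof cases
    case 1 then show ?thesis using that assms(1) by blast
  next
    case 2 then show ?thesis using that r axis_reverse worm_tiles_reverse by blast
  next
    case 3 then show ?thesis using that f(1) worm_tiles_uminus by blast
  next
    case 4 then show ?thesis
      using that[of "\<lambda>i. c (- i)" "\<lambda>i. - v (- i)"] f(2) axis_reverse worm_tiles_uminus worm_tiles_reverse by simp
  qed
qed

section \<open>Existence and uniqueness of worms\<close>

context para_tiling
begin

lemma half_worm_exists:
  assumes "para c0 u v0 \<in> \<T>" "\<sigma> * cross2 u v0 > 0"
  obtains f :: "nat \<Rightarrow> plane \<times> plane" where "f 0 = (c0, v0)"
    "\<And>n. para (fst (f n)) u (snd (f n)) \<in> \<T>" "\<And>n. \<sigma> * cross2 u (snd (f n)) > 0"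
    "\<And>n. fst (f (Suc n)) = fst (f n) + snd (f n) + snd (f (Suc n))"
proof -
  \<comment> \<open>The clause for \<open>n = 0\<close> forces dependent choice to start at the
    given tile.\<close>
  let ?P = "\<lambda>(n::nat) x. para (fst x) u (snd x) \<in> \<T> \<and> \<sigma> * cross2 u (snd x) > 0 \<and> (n = 0 \<longrightarrow> x = (c0, v0))"
  have "\<exists>f. \<forall>n. ?P n (f n) \<and> fst (f (Suc n)) = fst (f n) + snd (f n) + snd (f (Suc n))"
  proof (rule dependent_nat_choice)
    show "\<exists>x. ?P 0 x" using assms by auto
  next
    fix x :: "plane \<times> plane" and n assume x: "?P n x"
    then have "cross2 u (snd x) \<noteq> 0" by auto
    then obtain v' where v': "para (fst x + snd x + v') u v' \<in> \<T>" "cross2 u (snd x) * cross2 u v' > 0"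
      using neighbour_exists x by blast
    have "\<sigma> * cross2 u v' > 0" using x v'(2) by (auto simp: zero_less_mult_iff)
    then show "\<exists>y. ?P (Suc n) y \<and> fst y = fst x + snd x + snd y"
      using v'(1) by (intro exI[of _ "(fst x + snd x + v', v')"]) simp
  qed
  then show ?thesis using that by blast
qed

lemma worm_exists:
  assumes "para c0 u v0 \<in> \<T>" "\<sigma> * cross2 u v0 > 0"
  obtains c v where "worm_data \<T> \<sigma> u c v" "c 0 = c0" "v 0 = v0"
proof -
  obtain f where f: "f 0 = (c0, v0)" "\<And>n::nat. para (fst (f n)) u (snd (f n)) \<in> \<T>"
    "\<And>n. \<sigma> * cross2 u (snd (f n)) > 0" "\<And>n. fst (f (Suc n)) = fst (f n) + snd (f n) + snd (f (Suc n))"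
    using half_worm_exists[OF assms] by blast
  \<comment> \<open>The half with negative indices starts at the opposite edge, with
    \<open>v\<close> and \<open>\<sigma>\<close> negated; both halves contain the initial tile as
    index 0.\<close>
  have "para c0 u (- v0) \<in> \<T>" "(- \<sigma>) * cross2 u (- v0) > 0"
    using assms by (simp_all add: para_uminus cross2_simps)
  then obtain g where g: "g 0 = (c0, - v0)" "\<And>n::nat. para (fst (g n)) u (snd (g n)) \<in> \<T>"
    "\<And>n. (- \<sigma>) * cross2 u (snd (g n)) > 0" "\<And>n. fst (g (Suc n)) = fst (g n) + snd (g n) + snd (g (Suc n))"
    using half_worm_exists by blast
  define c where "c i = (if i \<ge> 0 then fst (f (nat i)) else fst (g (nat (- i))))" for i :: int
  define v where "v i = (if i \<ge> 0 then snd (f (nat i)) else - snd (g (nat (- i))))" for i :: int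
  have cf: "c (int n) = fst (f n)" "v (int n) = snd (f n)" for n
    by (simp_all add: c_def v_def)
  have cg: "c (- int n) = fst (g n)" "v (- int n) = - snd (g n)" for n
    by (cases "n = 0"; simp add: c_def v_def f(1) g(1))+
  have "para (c i) u (v i) \<in> \<T> \<and> \<sigma> * cross2 u (v i) > 0" for i
    using f(2)[of "nat i"] f(3)[of "nat i"] g(2)[of "nat (- i)"] g(3)[of "nat (- i)"]
    by (auto simp: c_def v_def para_uminus cross2_simps)
  moreover have "c (i + 1) = c i + v i + v (i + 1)" for i
  proof (cases "i \<ge> 0")
    case True
    then obtain n where i: "i = int n" by (metis nonneg_int_cases)
    have "i + 1 = int (Suc n)" using i by simp
    then show ?thesis using f(4)[of n] i cf by metis
  next
    case False
    then have i: "i = - int (Suc n)" if "n = nat (- i - 1)" for n using that by simp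
    define n where "n = nat (- i - 1)"
    note i = i[OF n_def]
    then have i1: "i + 1 = - int n" by simp
    show ?thesis unfolding i1 unfolding i cg g(4)[of n] by simp
  qed
  ultimately have "worm_data \<T> \<sigma> u c v" unfolding worm_data_def by blast
  moreover have "c 0 = c0" "v 0 = v0" using f(1) by (simp_all add: c_def v_def)
  ultimately show ?thesis using that by blast
qed

text \<open>Uniqueness of the neighbour propagates in both directions; downwards it is applied at
  the midpoint \<open>c - v\<close> with negated half-sides.\<close>

lemma worm_determined:
  assumes W: "worm_data \<T> \<sigma> u c v" and W': "worm_data \<T> \<sigma> u c' v'" and eq: "c i = c' j" "v i = v' j"
  shows "c (i + n) = c' (j + n) \<and> v (i + n) = v' (j + n)"
proof (induction n rule: int_induct[where k = 0])
  case base
  then show ?case using eq by simp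
next
  case (step1 n)
  let ?m = "c (i + n) + v (i + n)"
  have "c (i + n + 1) = ?m + v (i + n + 1)" "c' (j + n + 1) = ?m + v' (j + n + 1)"
    using worm_dataD(3)[OF W, of "i + n"] worm_dataD(3)[OF W', of "j + n"] step1 by simp_all
  moreover have "v (i + n + 1) = v' (j + n + 1)"
  proof (rule neighbour_unique)
    show "para (?m + v (i + n + 1)) u (v (i + n + 1)) \<in> \<T>" "para (?m + v' (j + n + 1)) u (v' (j + n + 1)) \<in> \<T>"
      using calculation worm_dataD(1)[OF W, of "i + n + 1"] worm_dataD(1)[OF W', of "j + n + 1"] by simp_all
    show "0 < cross2 u (v (i + n + 1)) * cross2 u (v' (j + n + 1))"
      using worm_dataD(2)[OF W, of "i + n + 1"] worm_dataD(2)[OF W', of "j + n + 1"]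
      by (auto simp: zero_less_mult_iff)
  qed
  ultimately show ?case by (simp add: add.assoc)
next
  case (step2 n)
  let ?m = "c (i + n) - v (i + n)"
  have e: "?m + - v (i + n - 1) = c (i + n - 1)" "?m + - v' (j + n - 1) = c' (j + n - 1)"
    using worm_dataD(3)[OF W, of "i + n - 1"] worm_dataD(3)[OF W', of "j + n - 1"] step2
    by (simp_all add: algebra_simps)
  have vv: "- v (i + n - 1) = - v' (j + n - 1)"
  proof (rule neighbour_unique)
    show "para (?m + - v (i + n - 1)) u (- v (i + n - 1)) \<in> \<T>"
      unfolding e para_uminus by (rule worm_dataD(1)[OF W])
    show "para (?m + - v' (j + n - 1)) u (- v' (j + n - 1)) \<in> \<T>"
      unfolding e para_uminus by (rule worm_dataD(1)[OF W'])
    show "0 < cross2 u (- v (i + n - 1)) * cross2 u (- v' (j + n - 1))"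
      using worm_dataD(2)[OF W, of "i + n - 1"] worm_dataD(2)[OF W', of "j + n - 1"]
      by (auto simp: zero_less_mult_iff cross2_simps)
  qed
  have "c (i + n - 1) = c' (j + n - 1)" using e unfolding vv by simp
  then show ?case using vv by (simp add: add_diff_eq)
qed

text \<open>A point of an axis is in the open tile of its segment except at the two ends, which are
  midpoints of shared edges and lie in no further tiles.\<close>

lemma tile_at_axis:
  assumes W: "worm_data \<T> \<sigma> u c v" and s: "\<bar>s\<bar> \<le> 1" and B: "B \<in> \<T>" "c i + s *\<^sub>R v i \<in> B"
  shows "B = para (c i) u (v i) \<or> s = 1 \<and> B = para (c (i + 1)) u (v (i + 1))
    \<or> s = -1 \<and> B = para (c (i - 1)) u (v (i - 1))"
proof -
  consider "\<bar>s\<bar> < 1" | "s = 1" | "s = -1" using s by linarith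
  then show ?thesis
  proof cases
    case 1
    have "c i + 0 *\<^sub>R u + s *\<^sub>R v i \<in> para_open (c i) u (v i)"
      unfolding para_open_def using 1 by (intro CollectI exI[of _ "0::real"] exI[of _ s]) simp
    then show ?thesis
      using para_overlap[OF worm_dataD(1)[OF W] worm_dataD(4)[OF W] B(1)] B(2) by auto
  next
    case 2
    then show ?thesis
      using tile_at_edge_midpoint[of "c i" u "v i" "v (i + 1)" B] worm_dataD(1)[OF W, of i]
        worm_dataD(1)[OF W, of "i + 1"] worm_dataD(3)[OF W, of i] worm_dataD(5)[OF W] B by auto
  next
    case 3
    have c: "c (i - 1) = c i + - v i + - v (i - 1)" using worm_dataD(3)[OF W, of "i - 1"] by simp
    have "B = para (c i) u (- v i) \<or> B = para (c i + - v i + - v (i - 1)) u (- v (i - 1))"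
    proof (rule tile_at_edge_midpoint)
      show "para (c i) u (- v i) \<in> \<T>" using worm_dataD(1)[OF W, of i] by (simp add: para_uminus)
      show "para (c i + - v i + - v (i - 1)) u (- v (i - 1)) \<in> \<T>"
        unfolding c[symmetric] using worm_dataD(1)[OF W, of "i - 1"] by (simp add: para_uminus)
      show "0 < cross2 u (- v i) * cross2 u (- v (i - 1))"
        using worm_dataD(5)[OF W, of i "i - 1"] by (simp add: cross2_simps)
    qed (use B 3 in auto)
    then show ?thesis using 3 unfolding c[symmetric] para_uminus by blast
  qed
qed

lemma axes_meet:
  assumes "worm_data \<T> \<sigma> u c v" "worm_data \<T> \<tau> u' c' v'" "axis c v \<inter> axis c' v' \<noteq> {}"
  shows "worm_tiles u c v \<inter> worm_tiles u' c' v' \<noteq> {}"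
proof -
  obtain i s j t where p: "c i + s *\<^sub>R v i = c' j + t *\<^sub>R v' j" "\<bar>s\<bar> \<le> 1" "\<bar>t\<bar> \<le> 1"
    using assms(3) unfolding axis_def by auto
  have "c i + s *\<^sub>R v i \<in> para (c' j) u' (v' j)"
    using paraI[of 0 t "c' j" u' "v' j"] p by simp
  from tile_at_axis[OF assms(1) p(2) worm_dataD(1)[OF assms(2)] this]
  have "para (c' j) u' (v' j) \<in> worm_tiles u c v"
    unfolding worm_tiles_def by auto
  then show ?thesis unfolding worm_tiles_def by blast
qed

end


section \<open>Angles and transversal worms\<close>

text \<open>The unoriented angle; its orientation is carried by the sign of
  \<open>cross2\<close>.\<close>

definition vangle :: "plane \<Rightarrow> plane \<Rightarrow> real" where
  "vangle x y = arccos (x \<bullet> y / (norm x * norm y))"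

lemma vangle_arg_bounds:
  "- 1 \<le> (x::plane) \<bullet> y / (norm x * norm y)" "(x::plane) \<bullet> y / (norm x * norm y) \<le> 1"
proof -
  have "\<bar>x \<bullet> y / (norm x * norm y)\<bar> \<le> 1"
  proof (cases "norm x * norm y = 0")
    case False
    then have "norm x * norm y > 0" by (simp add: less_le)
    then show ?thesis using Cauchy_Schwarz_ineq2[of x y] by (simp add: abs_divide abs_mult)
  qed auto
  then show "- 1 \<le> x \<bullet> y / (norm x * norm y)" "x \<bullet> y / (norm x * norm y) \<le> 1" by linarith+
qed

lemma vangle_bounds: "0 \<le> vangle x y" "vangle x y \<le> pi"
  unfolding vangle_def using vangle_arg_bounds by (simp_all add: arccos_lbound arccos_ubound)

lemma vangle_uminus: "vangle x (- y) = pi - vangle x y"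
  unfolding vangle_def using arccos_minus[OF vangle_arg_bounds] by simp

lemma cos_vangle:
  assumes "x \<noteq> 0" "y \<noteq> 0"
  shows "norm x * norm y * cos (vangle x y) = x \<bullet> y"
  unfolding vangle_def using vangle_arg_bounds[of x y] assms by simp

lemma sin_vangle:
  assumes "x \<noteq> 0" "y \<noteq> 0"
  shows "norm x * norm y * sin (vangle x y) = \<bar>cross2 x y\<bar>"
proof -
  have "(norm x * norm y * sin (vangle x y))\<^sup>2 = (norm x * norm y)\<^sup>2 - (norm x * norm y * cos (vangle x y))\<^sup>2"
    by (simp add: power_mult_distrib sin_squared_eq algebra_simps)
  also have "\<dots> = (cross2 x y)\<^sup>2"
    unfolding cos_vangle[OF assms] cross2_sq by (simp add: power_mult_distrib)
  finally have "\<bar>norm x * norm y * sin (vangle x y)\<bar> = \<bar>cross2 x y\<bar>"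
    by (simp only: abs_eq_iff power2_eq_iff)
  moreover have "norm x * norm y * sin (vangle x y) \<ge> 0"
    by (intro mult_nonneg_nonneg sin_ge_zero vangle_bounds) auto
  ultimately show ?thesis by simp
qed

text \<open>The order given by a convex cone: \<open>\<sigma> * cross2 u\<close> is the height, and
  \<open>k\<close> bounds the sideways drift per height. Transitivity carries the estimate for a
  single tile over to a whole axis.\<close>

definition cone_le :: "real \<Rightarrow> real \<Rightarrow> plane \<Rightarrow> plane \<Rightarrow> plane \<Rightarrow> bool" where
  "cone_le k \<sigma> u p q \<longleftrightarrow> 0 \<le> \<sigma> * cross2 u (q - p) \<and> \<bar>u \<bullet> (q - p)\<bar> \<le> k * (\<sigma> * cross2 u (q - p))"

lemma cone_le_refl: "cone_le k \<sigma> u p p"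
  by (simp add: cone_le_def cross2_simps)

lemma cone_le_trans:
  assumes "cone_le k \<sigma> u p q" "cone_le k \<sigma> u q r"
  shows "cone_le k \<sigma> u p r"
proof -
  have "r - p = (q - p) + (r - q)" by simp
  then have e: "\<sigma> * cross2 u (r - p) = \<sigma> * cross2 u (q - p) + \<sigma> * cross2 u (r - q)"
      "u \<bullet> (r - p) = u \<bullet> (q - p) + u \<bullet> (r - q)"
    by (simp_all only: cross2_simps inner_add_right distrib_left)
  show ?thesis
    unfolding cone_le_def e distrib_left
    using assms[unfolded cone_le_def] abs_triangle_ineq[of "u \<bullet> (q - p)" "u \<bullet> (r - q)"] by linarith
qed

section \<open>Worms under a lower bound for the angles\<close>

locale angled_tiling = para_tiling +
  fixes \<alpha> :: real
  assumes \<alpha>_pos: "0 < \<alpha>"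
    and angle_ge: "para c u v \<in> \<T> \<Longrightarrow> cross2 u v \<noteq> 0 \<Longrightarrow> \<alpha> \<le> vangle u v"
begin

lemma angle_le:
  assumes "para c u v \<in> \<T>" "cross2 u v \<noteq> 0"
  shows "vangle u v \<le> pi - \<alpha>"
  using angle_ge[of c u "- v"] assms by (simp add: para_uminus cross2_simps vangle_uminus)

text \<open>An angle of a tile and its supplement are both at least \<open>\<alpha>\<close>.\<close>

lemma \<alpha>_le: "\<alpha> \<le> pi / 2"
proof -
  obtain A where "A \<in> \<T>" using tile_cover by blast
  moreover from this obtain c u v where "A = para c u v" "cross2 u v \<noteq> 0" using tile_para by blast
  ultimately show ?thesis using angle_le angle_ge by fastforce
qed

lemma sin_\<alpha>: "sin \<alpha> > 0" and cos_\<alpha>: "cos \<alpha> \<ge> 0"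
  using \<alpha>_pos \<alpha>_le by (simp_all add: sin_gt_zero cos_ge_zero)

text \<open>An angle between \<open>\<alpha>\<close> and \<open>pi - \<alpha>\<close> has a
  cotangent of absolute value at most \<open>cot \<alpha>\<close>. That the sines of the angle plus
  and minus \<open>\<alpha>\<close> are nonnegative says this without division.\<close>

lemma tile_cone:
  assumes "para c u v \<in> \<T>" "cross2 u v \<noteq> 0"
  shows "\<bar>u \<bullet> v\<bar> \<le> cot \<alpha> * \<bar>cross2 u v\<bar>"
proof -
  have nz: "u \<noteq> 0" "v \<noteq> 0" using assms(2) by (auto simp: cross2_simps)
  let ?t = "vangle u v" and ?N = "norm u * norm v"
  have "sin (?t - \<alpha>) \<ge> 0" "sin (?t + \<alpha>) \<ge> 0"
    using angle_ge[OF assms] angle_le[OF assms] \<alpha>_pos \<alpha>_le vangle_bounds[of u v]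
    by (auto intro!: sin_ge_zero)
  then have "sin \<alpha> * cos ?t \<le> cos \<alpha> * sin ?t" "- (cos \<alpha> * sin ?t) \<le> sin \<alpha> * cos ?t"
    by (simp_all add: sin_diff sin_add mult.commute)
  then have "?N * (sin \<alpha> * cos ?t) \<le> ?N * (cos \<alpha> * sin ?t)" "?N * - (cos \<alpha> * sin ?t) \<le> ?N * (sin \<alpha> * cos ?t)"
    by (intro mult_left_mono; simp)+
  moreover have "?N * (sin \<alpha> * cos ?t) = sin \<alpha> * (u \<bullet> v)" "?N * (cos \<alpha> * sin ?t) = cos \<alpha> * \<bar>cross2 u v\<bar>"
    unfolding cos_vangle[OF nz, symmetric] sin_vangle[OF nz, symmetric] by simp_all
  ultimately have "\<bar>sin \<alpha> * (u \<bullet> v)\<bar> \<le> cos \<alpha> * \<bar>cross2 u v\<bar>" by simp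
  then show ?thesis using sin_\<alpha> by (simp add: cot_def abs_mult field_simps)
qed

lemma cot_nonneg: "cot \<alpha> \<ge> 0"
  using sin_\<alpha> cos_\<alpha> by (simp add: cot_def)

context
  fixes \<sigma> u c v
  assumes W: "worm_data \<T> \<sigma> u c v" and \<sigma>: "\<sigma> = 1 \<or> \<sigma> = -1"
begin

lemma worm_cone_segment:
  assumes "s \<le> t"
  shows "cone_le (cot \<alpha>) \<sigma> u (c i + s *\<^sub>R v i) (c i + t *\<^sub>R v i)"
proof -
  have d: "(c i + t *\<^sub>R v i) - (c i + s *\<^sub>R v i) = (t - s) *\<^sub>R v i" by (simp add: algebra_simps)
  have eq: "\<sigma> * cross2 u (v i) = \<bar>cross2 u (v i)\<bar>" using worm_dataD(2)[OF W, of i] \<sigma> by auto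
  have "(t - s) * \<bar>u \<bullet> v i\<bar> \<le> (t - s) * (cot \<alpha> * \<bar>cross2 u (v i)\<bar>)"
    using assms tile_cone[OF worm_dataD(1,4)[OF W]] by (intro mult_left_mono) auto
  moreover have "\<sigma> * cross2 u ((t - s) *\<^sub>R v i) = (t - s) * \<bar>cross2 u (v i)\<bar>"
    unfolding eq[symmetric] by (simp add: cross2_simps)
  moreover have "\<bar>u \<bullet> ((t - s) *\<^sub>R v i)\<bar> = (t - s) * \<bar>u \<bullet> v i\<bar>"
    using assms by (simp add: abs_mult)
  moreover have "0 \<le> (t - s) * \<bar>cross2 u (v i)\<bar>" using assms by simp
  ultimately show ?thesis unfolding cone_le_def d by (simp add: mult.left_commute)
qed

lemma worm_cone_edges: "cone_le (cot \<alpha>) \<sigma> u (c i + v i) (c (i + int n) + v (i + int n))"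
proof (induction n)
  case 0
  show ?case by (simp add: cone_le_refl)
next
  case (Suc n)
  have "c (i + int (Suc n)) + (-1) *\<^sub>R v (i + int (Suc n)) = c (i + int n) + v (i + int n)"
    using worm_dataD(3)[OF W, of "i + int n"] by (simp add: add.assoc add.commute[of 1])
  then have "cone_le (cot \<alpha>) \<sigma> u (c (i + int n) + v (i + int n)) (c (i + int (Suc n)) + 1 *\<^sub>R v (i + int (Suc n)))"
    using worm_cone_segment[of "-1" 1 "i + int (Suc n)"] by simp
  then show ?case using cone_le_trans[OF Suc] by simp
qed

lemma worm_cone:
  assumes "i < j" "\<bar>s\<bar> \<le> 1" "\<bar>t\<bar> \<le> 1"
  shows "cone_le (cot \<alpha>) \<sigma> u (c i + s *\<^sub>R v i) (c j + t *\<^sub>R v j)"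
proof -
  \<comment> \<open>From the exit edge of tile \<open>i\<close>, \<open>n\<close> whole tiles are
    passed before tile \<open>j\<close> is entered.\<close>
  define n where "n = nat (j - i - 1)"
  have n: "j = i + int n + 1" using assms(1) by (simp add: n_def)
  have 1: "cone_le (cot \<alpha>) \<sigma> u (c i + s *\<^sub>R v i) (c i + v i)"
    using assms(2) worm_cone_segment[of s 1 i] by simp
  have 2: "cone_le (cot \<alpha>) \<sigma> u (c i + v i) (c (i + int n) + v (i + int n))"
    by (rule worm_cone_edges)
  have "c j + (-1) *\<^sub>R v j = c (i + int n) + v (i + int n)"
    using worm_dataD(3)[OF W, of "i + int n"] by (simp add: n)
  then have 3: "cone_le (cot \<alpha>) \<sigma> u (c (i + int n) + v (i + int n)) (c j + t *\<^sub>R v j)"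
    using assms(3) worm_cone_segment[of "-1" t j] by simp
  show ?thesis using cone_le_trans[OF cone_le_trans[OF 1 2] 3] .
qed

lemma worm_centres_increase:
  assumes "i < j"
  shows "\<sigma> * cross2 u (c i) < \<sigma> * cross2 u (c j)"
proof -
  have "cone_le (cot \<alpha>) \<sigma> u (c i + 1 *\<^sub>R v i) (c j + 0 *\<^sub>R v j)"
    using assms by (intro worm_cone) auto
  then show ?thesis
    using worm_dataD(2)[OF W, of i] by (simp add: cone_le_def cross2_simps right_diff_distrib distrib_left)
qed

lemma inj_worm_tiles: "inj (\<lambda>i. para (c i) u (v i))"
proof (rule injI)
  fix i j assume "para (c i) u (v i) = para (c j) u (v j)"
  then have "c i = c j" using para_centre_unique worm_dataD(4)[OF W] by blast
  then show "i = j" using worm_centres_increase[of i j] worm_centres_increase[of j i] by force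
qed

text \<open>With bounded heights the slope bound would keep the midpoints of the shared edges in a
  ball, which would meet infinitely many tiles.\<close>

lemma worm_height_unbounded: "\<exists>n::nat. x \<le> \<sigma> * cross2 u (c (int n) + v (int n))"
proof (rule ccontr)
  define e where "e n = c (int n) + v (int n)" for n
  assume "\<not> ?thesis"
  then have lt: "\<sigma> * cross2 u (e n) < x" for n unfolding e_def by (simp add: not_le)
  \<comment> \<open>\<open>norm u\<close> times the length of a vector is at most the sum of the
    absolute values of its determinant and inner product with \<open>u\<close>; the slope bound
    makes this at most \<open>cot \<alpha> + 1\<close> times the gain in height.\<close>
  define R where "R = (cot \<alpha> + 1) * (x - \<sigma> * cross2 u (e 0)) / norm u"
  have u: "norm u > 0" using worm_dataD(4)[OF W, of 0] by (auto simp: cross2_simps)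
  have near: "e n \<in> cball (e 0) R" for n
  proof -
    let ?w = "e n - e 0"
    have cone: "cone_le (cot \<alpha>) \<sigma> u (e 0) (e n)"
      using worm_cone_edges[of 0 n] by (simp add: e_def)
    have "(norm u * norm ?w)\<^sup>2 = (cross2 u ?w)\<^sup>2 + (u \<bullet> ?w)\<^sup>2"
      by (simp add: cross2_sq power_mult_distrib)
    also have "\<dots> \<le> (\<bar>cross2 u ?w\<bar> + \<bar>u \<bullet> ?w\<bar>)\<^sup>2"
      by (simp add: power2_sum)
    finally have "norm u * norm ?w \<le> \<bar>cross2 u ?w\<bar> + \<bar>u \<bullet> ?w\<bar>"
      by (rule power2_le_imp_le) simp
    also have "\<bar>cross2 u ?w\<bar> = \<sigma> * cross2 u ?w"
      using cone \<sigma> unfolding cone_le_def by auto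
    also have "\<sigma> * cross2 u ?w + \<bar>u \<bullet> ?w\<bar> \<le> (cot \<alpha> + 1) * (\<sigma> * cross2 u ?w)"
      using cone unfolding cone_le_def by (simp add: algebra_simps)
    also have "\<dots> \<le> (cot \<alpha> + 1) * (x - \<sigma> * cross2 u (e 0))"
      using cot_nonneg lt[of n] by (intro mult_left_mono) (simp_all add: cross2_simps right_diff_distrib)
    finally have "norm ?w \<le> R" using u by (simp add: R_def field_simps)
    then show ?thesis by (simp add: dist_norm norm_minus_commute)
  qed
  have "e n \<in> para (c (int n)) u (v (int n))" for n
    using paraI[of 0 1 "c (int n)" u "v (int n)"] by (simp add: e_def)
  then have "range (\<lambda>n. para (c (int n)) u (v (int n))) \<subseteq> {A \<in> \<T>. A \<inter> cball (e 0) R \<noteq> {}}"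
    using near worm_dataD(1)[OF W] by blast
  then have "finite (range (\<lambda>n. para (c (int n)) u (v (int n))))"
    using finite_tiles_meeting_bounded[OF bounded_cball] finite_subset by blast
  moreover have "inj (\<lambda>n. para (c (int n)) u (v (int n)))"
    using inj_compose[OF inj_worm_tiles inj_of_nat] by (simp add: comp_def)
  ultimately show False using finite_imageD infinite_UNIV_nat by blast
qed

lemma worm_height_between:
  assumes "\<sigma> * cross2 u (c i + v i) \<le> x" "x \<le> \<sigma> * cross2 u (c (i + int n) + v (i + int n))"
  shows "\<exists>p\<in>axis c v. \<sigma> * cross2 u p = x"
  using assms(2)
proof (induction n)
  case 0
  then have "\<sigma> * cross2 u (c i + 1 *\<^sub>R v i) = x" using assms(1) by simp
  then show ?case using axisI[of 1 c i v] by auto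
next
  case (Suc n)
  show ?case
  proof (cases "x \<le> \<sigma> * cross2 u (c (i + int n) + v (i + int n))")
    case True
    then show ?thesis using Suc by blast
  next
    case False
    define j where "j = i + int (Suc n)"
    define b where "b = \<sigma> * cross2 u (v j)"
    define s where "s = (x - \<sigma> * cross2 u (c j)) / b"
    have b: "b > 0" using worm_dataD(2)[OF W] by (simp add: b_def)
    have "c j - v j = c (i + int n) + v (i + int n)"
      using worm_dataD(3)[OF W, of "i + int n"] by (simp add: j_def add.assoc add.commute[of 1])
    then have "\<sigma> * cross2 u (c j) - b < x"
      using False by (metis b_def cross2_simps(4) not_le right_diff_distrib)
    moreover have "x \<le> \<sigma> * cross2 u (c j) + b"
      using Suc.prems by (simp add: j_def b_def cross2_simps distrib_left)
    ultimately have "\<bar>s\<bar> \<le> 1" using b by (simp add: s_def abs_le_iff field_simps)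
    moreover have "\<sigma> * cross2 u (c j + s *\<^sub>R v j) = \<sigma> * cross2 u (c j) + s * b"
      by (simp add: cross2_simps b_def distrib_left)
    moreover have "s * b = x - \<sigma> * cross2 u (c j)" using b by (simp add: s_def)
    ultimately show ?thesis using axisI[of s c j v] by (intro bexI[of _ "c j + s *\<^sub>R v j"]) simp_all
  qed
qed

end

lemma worm_line_graph:
  assumes W: "worm_data \<T> \<sigma> u c v" and \<sigma>: "\<sigma> = 1 \<or> \<sigma> = -1"
  shows "line_graph (cot \<alpha>) u (axis c v)"
  unfolding line_graph_def
proof (intro conjI ballI allI)
  have cone_imp: "\<bar>u \<bullet> (q - p)\<bar> \<le> cot \<alpha> * \<bar>cross2 u (q - p)\<bar>" if "cone_le (cot \<alpha>) \<sigma> u p q" for p q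
  proof -
    have "\<sigma> * cross2 u (q - p) = \<bar>cross2 u (q - p)\<bar>"
      using that \<sigma> unfolding cone_le_def by auto
    then show ?thesis using that unfolding cone_le_def by simp
  qed
  fix p q assume "p \<in> axis c v" "q \<in> axis c v"
  then obtain i s j t where pq: "p = c i + s *\<^sub>R v i" "\<bar>s\<bar> \<le> 1" "q = c j + t *\<^sub>R v j" "\<bar>t\<bar> \<le> 1"
    unfolding axis_def by auto
  have "cone_le (cot \<alpha>) \<sigma> u p q \<or> cone_le (cot \<alpha>) \<sigma> u q p"
  proof (cases i j rule: linorder_cases)
    case less
    then show ?thesis using worm_cone[OF W \<sigma>] pq by blast
  next
    case equal
    then show ?thesis using worm_cone_segment[OF W \<sigma>, of s t i] worm_cone_segment[OF W \<sigma>, of t s i] pq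
      by (metis linear)
  next
    case greater
    then show ?thesis using worm_cone[OF W \<sigma>] pq by blast
  qed
  then show "\<bar>u \<bullet> (q - p)\<bar> \<le> cot \<alpha> * \<bar>cross2 u (q - p)\<bar>"
  proof
    assume "cone_le (cot \<alpha>) \<sigma> u q p"
    moreover have "u \<bullet> (q - p) = - (u \<bullet> (p - q))" "cross2 u (q - p) = - cross2 u (p - q)"
      by (simp_all add: inner_diff_right cross2_simps)
    ultimately show ?thesis using cone_imp[of q p] by simp
  qed (rule cone_imp)
next
  fix h
  note R = worm_data_reverse[OF W]
  have \<sigma>': "- \<sigma> = 1 \<or> - \<sigma> = -1" using \<sigma> by auto
  obtain n :: nat where n: "\<sigma> * h \<le> \<sigma> * cross2 u (c (int n) + v (int n))"
    using worm_height_unbounded[OF W \<sigma>] by blast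
  \<comment> \<open>Low heights come from the reversed worm. Its edge number \<open>m\<close> is the
    edge between the tiles \<open>- m - 1\<close> and \<open>- m\<close>, hence the starting index
    \<open>- m - 1\<close> below.\<close>
  obtain m :: nat where m: "- \<sigma> * h \<le> - \<sigma> * cross2 u (c (- int m) + - v (- int m))"
    using worm_height_unbounded[OF R \<sigma>'] by blast
  have "c (- int m) = c (- int m - 1) + v (- int m - 1) + v (- int m)"
    using worm_dataD(3)[OF W, of "- int m - 1"] by simp
  then have "c (- int m) + - v (- int m) = c (- int m - 1) + v (- int m - 1)" by simp
  then have "\<sigma> * cross2 u (c (- int m - 1) + v (- int m - 1)) \<le> \<sigma> * h"
    using m by simp
  moreover have "- int m - 1 + int (n + m + 1) = int n" by simp
  ultimately obtain p where "p \<in> axis c v" "\<sigma> * cross2 u p = \<sigma> * h"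
    using worm_height_between[OF W \<sigma>, of "- int m - 1" "\<sigma> * h" "n + m + 1"] n by metis
  then show "\<exists>p\<in>axis c v. cross2 u p = h" using \<sigma> by auto
qed

section \<open>Crossings of two transversal worms\<close>

context
  fixes \<sigma> u c v u' c' v'
  assumes W: "worm_data \<T> \<sigma> u c v" and X: "worm_data \<T> \<sigma> u' c' v'"
    and \<sigma>: "\<sigma> = 1 \<or> \<sigma> = -1" and transversal: "\<sigma> * cross2 u u' > 0"
begin

text \<open>As \<open>u\<close> and \<open>u'\<close> are not parallel, \<open>u'\<close> must be
  \<open>v k\<close> up to sign; since \<open>cross2 u u'\<close> and \<open>cross2 u (v k)\<close>
  both have the sign \<open>\<sigma>\<close>, it is \<open>v k\<close> itself.\<close>

lemma crossing_tileD:
  assumes "para (c k) u (v k) = para (c' l) u' (v' l)"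
  shows "v k = u'" "c k = c' l" "v' l = u \<or> v' l = - u"
proof -
  have uu: "cross2 u u' \<noteq> 0" using transversal by auto
  have nz: "cross2 u (v k) \<noteq> 0" "cross2 u' (v' l) \<noteq> 0" using worm_dataD(4)[OF W] worm_dataD(4)[OF X] by auto
  have "(u' = v k \<or> u' = - v k) \<and> (v' l = u \<or> v' l = - u)"
    using para_eqD[OF nz assms] uu by (auto simp: cross2_simps)
  moreover have "u' \<noteq> - v k"
    using transversal worm_dataD(2)[OF W, of k] by (auto simp: cross2_simps)
  ultimately show "v k = u'" "v' l = u \<or> v' l = - u" by auto
  show "c k = c' l" using para_centre_unique[OF nz(1) assms] .
qed

text \<open>In a common tile the axis segment runs along \<open>u'\<close> through a centre on the
  other axis, so its parameter is the offset: the crossing leads from -1 to 1.\<close>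

lemma crossing_offset:
  assumes "para (c k) u (v k) \<in> worm_tiles u' c' v'"
  shows "offset u' (axis c' v') (c k + s *\<^sub>R v k) = s"
proof -
  obtain l where l: "para (c k) u (v k) = para (c' l) u' (v' l)"
    using assms unfolding worm_tiles_def by blast
  show ?thesis
    by (rule offset_eq[OF worm_line_graph[OF X \<sigma>]])
      (use crossing_tileD[OF l] centre_in_axis in simp)
qed

text \<open>By \<open>tile_at_axis\<close> the common point might belong to a common tile next to
  tile \<open>k\<close>, touched at the midpoint of a shared edge. This is excluded because inside a
  common tile the axes cross at the centre only.\<close>

lemma crossing_point_tile:
  assumes "c k + s *\<^sub>R v k \<in> axis c' v'" "\<bar>s\<bar> \<le> 1"
  shows "para (c k) u (v k) \<in> worm_tiles u' c' v'"
proof -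
  have uu: "cross2 u u' \<noteq> 0" using transversal by auto
  obtain l t where p: "c k + s *\<^sub>R v k = c' l + t *\<^sub>R v' l" "\<bar>t\<bar> \<le> 1"
    using assms(1) unfolding axis_def by auto
  have not_end: False if "c j + r *\<^sub>R v j = c' l + t *\<^sub>R v' l" "r = 1 \<or> r = -1"
    "para (c' l) u' (v' l) = para (c j) u (v j)" for j r
  proof -
    from crossing_tileD[OF that(3)[symmetric]]
    have "r *\<^sub>R u' = t *\<^sub>R v' l" "v' l = u \<or> v' l = - u" using that(1) by auto
    then have "cross2 u (r *\<^sub>R u') = 0" by (auto simp: cross2_simps)
    then show False using that(2) uu by (auto simp: cross2_simps)
  qed
  have "c k + s *\<^sub>R v k \<in> para (c' l) u' (v' l)"
    using paraI[of 0 t "c' l" u' "v' l"] p by simp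
  from tile_at_axis[OF W assms(2) worm_dataD(1)[OF X] this]
  have "para (c' l) u' (v' l) = para (c k) u (v k)"
  proof (elim disjE conjE)
    assume "s = 1" "para (c' l) u' (v' l) = para (c (k + 1)) u (v (k + 1))"
    moreover have "c (k + 1) + (-1) *\<^sub>R v (k + 1) = c k + 1 *\<^sub>R v k"
      using worm_dataD(3)[OF W, of k] by simp
    ultimately show ?thesis using not_end[of "k + 1" "-1"] p by simp
  next
    assume "s = -1" "para (c' l) u' (v' l) = para (c (k - 1)) u (v (k - 1))"
    moreover have "c (k - 1) + 1 *\<^sub>R v (k - 1) = c k + (-1) *\<^sub>R v k"
      using worm_dataD(3)[OF W, of "k - 1"] by simp
    ultimately show ?thesis using not_end[of "k - 1" 1] p by simp
  qed
  then show ?thesis unfolding worm_tiles_def by blast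
qed

text \<open>Every crossing goes from the negative to the positive side, so there is only one.\<close>

lemma crossing_above:
  assumes "para (c i) u (v i) \<in> worm_tiles u' c' v'" "i < k" "\<bar>s\<bar> \<le> 1"
  shows "para (c k) u (v k) \<notin> worm_tiles u' c' v'" "offset u' (axis c' v') (c k + s *\<^sub>R v k) > 0"
proof -
  note g = worm_line_graph[OF X \<sigma>]
  let ?d = "offset u' (axis c' v')"
  have step: "para (c (j + 1)) u (v (j + 1)) \<notin> worm_tiles u' c' v' \<and>
      (\<forall>s. \<bar>s\<bar> \<le> 1 \<longrightarrow> ?d (c (j + 1) + s *\<^sub>R v (j + 1)) > 0)" if pos: "?d (c j + 1 *\<^sub>R v j) > 0" for j
  proof -
    have start: "c (j + 1) + (-1) *\<^sub>R v (j + 1) = c j + 1 *\<^sub>R v j"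
      using worm_dataD(3)[OF W, of j] by simp
    \<comment> \<open>A crossing in the next tile would begin at offset -1, but it begins where the
      previous segment ends, at a positive offset.\<close>
    have out: "para (c (j + 1)) u (v (j + 1)) \<notin> worm_tiles u' c' v'"
    proof
      assume "para (c (j + 1)) u (v (j + 1)) \<in> worm_tiles u' c' v'"
      from crossing_offset[OF this, of "-1"] show False using pos start by simp
    qed
    let ?S = "(\<lambda>s. c (j + 1) + s *\<^sub>R v (j + 1)) ` {-1..1}"
    have "?d (c (j + 1) + s *\<^sub>R v (j + 1)) > 0" if "\<bar>s\<bar> \<le> 1" for s
    proof (rule offset_pos_on_connected[OF g, of ?S])
      show "connected ?S" by (intro connected_continuous_image continuous_intros connected_Icc)
      show "?S \<inter> axis c' v' = {}" using out crossing_point_tile by fastforce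
      show "c (j + 1) + (-1) *\<^sub>R v (j + 1) \<in> ?S" by (rule imageI) simp
      show "?d (c (j + 1) + (-1) *\<^sub>R v (j + 1)) > 0" using pos start by simp
      show "c (j + 1) + s *\<^sub>R v (j + 1) \<in> ?S" using that by (intro imageI) (auto simp: abs_le_iff)
    qed
    then show ?thesis using out by blast
  qed
  have all: "?d (c (i + int n) + 1 *\<^sub>R v (i + int n)) > 0" for n
  proof (induction n)
    case 0
    show ?case using crossing_offset[OF assms(1), of 1] by simp
  next
    case (Suc n)
    have "i + int (Suc n) = i + int n + 1" by simp
    then show ?case using step[OF Suc] by (metis abs_1 order_refl)
  qed
  define n where "n = nat (k - i - 1)"
  have k: "k = i + int n + 1" using assms(2) by (simp add: n_def)
  show "para (c k) u (v k) \<notin> worm_tiles u' c' v'" "?d (c k + s *\<^sub>R v k) > 0"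
    using step[OF all[of n]] assms(3) unfolding k by blast+
qed

end

lemma finite_edge_directions: "finite {w. \<exists>b z. B = para b w z \<and> cross2 w z \<noteq> 0}" (is "finite ?S")
proof (cases "?S = {}")
  case False
  then obtain b x y where B: "B = para b x y" "cross2 x y \<noteq> 0" by blast
  have "?S \<subseteq> {x, - x, y, - y}"
  proof
    fix w assume "w \<in> ?S"
    then obtain b' z where "B = para b' w z" "cross2 w z \<noteq> 0" by blast
    then show "w \<in> {x, - x, y, - y}" using para_eqD[OF B(2), of w z b b'] B(1) by auto
  qed
  then show ?thesis by (rule finite_subset) simp
next
  case True
  then show ?thesis by (simp only: finite.emptyI)
qed

text \<open>If \<open>t\<close> were on the negative side of all the transversal worms below it, infinitely many of
  them would pass through the bounded segment from \<open>W\<close> to \<open>t\<close>, hence two of them through the same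
  tile in the same direction.\<close>

lemma next_worm:
  assumes W: "worm_data \<T> \<sigma> u c v" and \<sigma>: "\<sigma> = 1 \<or> \<sigma> = -1"
  obtains i c' v' where "worm_data \<T> \<sigma> (v i) c' v'" "c' 0 = c i" "v' 0 = - u"
    "\<sigma> * cross2 u (c i) \<le> \<sigma> * cross2 u t" "offset (v i) (axis c' v') t \<ge> 0"
proof (rule ccontr)
  note g = worm_line_graph[OF W \<sigma>] and result = that
  assume contra: "\<not> thesis"
  have "\<exists>c' v'. worm_data \<T> \<sigma> (v i) c' v' \<and> c' 0 = c i \<and> v' 0 = - u" for i
  proof -
    have "para (c i) (v i) (- u) \<in> \<T>"
      using worm_dataD(1)[OF W, of i] by (simp add: para_uminus para_swap)
    moreover have "\<sigma> * cross2 (v i) (- u) > 0"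
      using worm_dataD(2)[OF W, of i] by (simp add: cross2_simps cross2_commute[of "v i" u])
    ultimately show ?thesis using worm_exists by metis
  qed
  then obtain cc vv where X: "\<And>i. worm_data \<T> \<sigma> (v i) (cc i) (vv i)"
    and X0: "\<And>i. cc i 0 = c i" "\<And>i. vv i 0 = - u" by metis
  have neg: "offset (v i) (axis (cc i) (vv i)) t < 0" if below: "\<sigma> * cross2 u (c i) \<le> \<sigma> * cross2 u t" for i
    using contra result[OF X X0 below] not_le by blast
  have own: "para (c i) u (v i) = para (cc i 0) (v i) (vv i 0)" for i
    by (simp add: X0 para_uminus para_swap)
  \<comment> \<open>The foot of \<open>t\<close> on the axis along \<open>u\<close>. It has the
    height of \<open>t\<close>, so the tiles of \<open>W\<close> before it have centres not above
    \<open>t\<close>.\<close>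
  define q where "q = t - offset u (axis c v) t *\<^sub>R u"
  have "q \<in> axis c v" unfolding q_def by (rule offset_mem[OF g])
  then obtain m r where q: "q = c m + r *\<^sub>R v m" "\<bar>r\<bar> \<le> 1" unfolding axis_def by auto
  have hq: "cross2 u q = cross2 u t" by (simp add: q_def cross2_simps)
  have "\<exists>j. para (cc i j) (v i) (vv i j) \<inter> closed_segment q t \<noteq> {}" if i: "i < m" for i
  proof -
    note gi = worm_line_graph[OF X \<sigma>, of i]
    have "cone_le (cot \<alpha>) \<sigma> u (c i + 0 *\<^sub>R v i) (c m + r *\<^sub>R v m)"
      using i q(2) by (intro worm_cone[OF W \<sigma>]) auto
    then have "\<sigma> * cross2 u (c i) \<le> \<sigma> * cross2 u t"
      using hq by (simp add: q(1)[symmetric] cone_le_def cross2_simps right_diff_distrib)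
    then have "offset (v i) (axis (cc i) (vv i)) t < 0" by (rule neg)
    moreover have "offset (v i) (axis (cc i) (vv i)) q > 0"
      unfolding q(1)
    proof (rule crossing_above(2)[OF W X \<sigma> _ _ i q(2)])
      show "\<sigma> * cross2 u (v i) > 0" by (rule worm_dataD(2)[OF W])
      show "para (c i) u (v i) \<in> worm_tiles (v i) (cc i) (vv i)"
        unfolding own worm_tiles_def by (rule rangeI)
    qed
    \<comment> \<open>The transversal axis has \<open>t\<close> on its negative side, and on its
      positive side \<open>q\<close>, which lies on \<open>W\<close> beyond tile
      \<open>i\<close>.\<close>
    ultimately have "closed_segment q t \<inter> axis (cc i) (vv i) \<noteq> {}"
      using offset_pos_on_connected[OF gi, of "closed_segment q t" q t] by fastforce
    then obtain j s where z: "cc i j + s *\<^sub>R vv i j \<in> closed_segment q t" "\<bar>s\<bar> \<le> 1"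
      unfolding axis_def by auto
    moreover have "cc i j + s *\<^sub>R vv i j \<in> para (cc i j) (v i) (vv i j)"
      using paraI[of 0 s "cc i j" "v i" "vv i j"] z(2) by simp
    ultimately show ?thesis by blast
  qed
  then obtain j where j: "\<And>i. i < m \<Longrightarrow> para (cc i (j i)) (v i) (vv i (j i)) \<inter> closed_segment q t \<noteq> {}"
    by metis
  \<comment> \<open>The direction is recorded because a tile alone does not determine the worm
    through it.\<close>
  define f where "f i = (para (cc i (j i)) (v i) (vv i (j i)), v i)" for i
  define F where "F = {B \<in> \<T>. B \<inter> closed_segment q t \<noteq> {}}"
  have "f ` {..<m} \<subseteq> (SIGMA B:F. {w. \<exists>b z. B = para b w z \<and> cross2 w z \<noteq> 0})"
    using j worm_dataD(1,4)[OF X] unfolding f_def F_def by blast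
  moreover have "finite F" unfolding F_def by (intro finite_tiles_meeting_bounded bounded_closed_segment)
  ultimately have "finite (f ` {..<m})"
    by (intro finite_subset[OF _ finite_SigmaI[OF _ finite_edge_directions]])
  moreover have "infinite {..<m}" by (rule infinite_Iio)
  ultimately obtain a where "a < m" "infinite {i \<in> {..<m}. f i = f a}"
    using pigeonhole_infinite[of "{..<m}" f] by auto
  then have "infinite ({i \<in> {..<m}. f i = f a} - {a})" by (simp add: infinite_remove)
  then obtain b where b: "b < m" "f b = f a" "b \<noteq> a"
    using infinite_imp_nonempty by blast
  \<comment> \<open>Same tile, direction and \<open>\<sigma>\<close>: the two worms agree up to a
    shift, so tile \<open>h\<close> of \<open>W\<close> lies on the worm through tile
    \<open>l\<close>, which would cross \<open>W\<close> twice.\<close>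
  define l h where "l = min a b" and "h = max a b"
  have lh: "l < h" "f l = f h" using b by (auto simp: l_def h_def min_def max_def)
  have vl: "v l = v h" and tl: "para (cc l (j l)) (v l) (vv l (j l)) = para (cc h (j h)) (v h) (vv h (j h))"
    using lh(2) unfolding f_def prod.inject by blast+
  have Xh: "worm_data \<T> \<sigma> (v l) (cc h) (vv h)" using X[of h] unfolding vl .
  note tl' = tl[folded vl]
  have cl: "cc l (j l) = cc h (j h)" using para_centre_unique[OF worm_dataD(4)[OF X] tl] .
  have "v l \<noteq> vv l (j l)" "v l \<noteq> - vv l (j l)"
    using worm_dataD(4)[OF X, of l "j l"] by (auto simp: cross2_simps)
  then have "vv h (j h) = vv l (j l) \<or> vv h (j h) = - vv l (j l)"
    using para_eqD[OF worm_dataD(4)[OF X] worm_dataD(4)[OF Xh] tl'] by blast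
  moreover have "vv h (j h) \<noteq> - vv l (j l)"
  proof
    assume "vv h (j h) = - vv l (j l)"
    then show False
      using worm_dataD(2)[OF X, of l "j l"] worm_dataD(2)[OF Xh, of "j h"] by (simp add: cross2_simps)
  qed
  ultimately have vvl: "vv l (j l) = vv h (j h)" by simp
  have "cc l (j l + - j h) = cc h (j h + - j h) \<and> vv l (j l + - j h) = vv h (j h + - j h)"
    by (rule worm_determined[OF X Xh cl vvl])
  then have "para (cc h 0) (v h) (vv h 0) = para (cc l (j l - j h)) (v l) (vv l (j l - j h))"
    using vl by simp
  then have "para (c h) u (v h) \<in> worm_tiles (v l) (cc l) (vv l)"
    unfolding own worm_tiles_def by blast
  moreover have "para (c h) u (v h) \<notin> worm_tiles (v l) (cc l) (vv l)"
  proof (rule crossing_above(1)[OF W X \<sigma> _ _ lh(1), of _ 0])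
    show "\<sigma> * cross2 u (v l) > 0" by (rule worm_dataD(2)[OF W])
    show "para (c l) u (v l) \<in> worm_tiles (v l) (cc l) (vv l)"
      unfolding own worm_tiles_def by (rule rangeI)
  qed simp
  ultimately show False by blast
qed

end


section \<open>The spiral\<close>

lemma vangle_uminus_both: "vangle (- x) (- y) = vangle x y"
  by (simp add: vangle_def)

text \<open>The addition theorems give both sides the same sine and cosine. A sum beyond pi would
  have a negative sine, while that of \<open>vangle y d'\<close> is nonnegative; up to pi the cosine
  is injective.\<close>

lemma vangle_add:
  assumes \<sigma>: "\<sigma> = 1 \<or> \<sigma> = -1" and y: "y \<noteq> 0"
    and yd: "0 \<le> \<sigma> * cross2 y d" and dd: "0 < \<sigma> * cross2 d d'" and yd': "0 \<le> \<sigma> * cross2 y d'"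
  shows "vangle y d' = vangle y d + vangle d d'"
proof -
  have nz: "d \<noteq> 0" "d' \<noteq> 0" using dd by (auto simp: cross2_simps)
  let ?a = "vangle y d" and ?b = "vangle d d'" and ?c = "vangle y d'"
  have abs: "\<bar>cross2 y d\<bar> = \<sigma> * cross2 y d" "\<bar>cross2 d d'\<bar> = \<sigma> * cross2 d d'" "\<bar>cross2 y d'\<bar> = \<sigma> * cross2 y d'"
    using \<sigma> yd dd yd' by auto
  have \<sigma>2: "\<sigma> * \<sigma> = 1" using \<sigma> by auto
  note trig = cos_vangle[OF y nz(1)] cos_vangle[OF nz] cos_vangle[OF y nz(2)]
    sin_vangle[OF y nz(1), unfolded abs] sin_vangle[OF nz, unfolded abs] sin_vangle[OF y nz(2), unfolded abs]
  define M where "M = (norm y * norm d) * (norm d * norm d')"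
  have M: "M > 0" using y nz by (simp add: M_def)
  have M': "M * z = (norm d * norm d) * (norm y * norm d' * z)" for z
    by (simp add: M_def)
  have dn: "norm d * norm d = d \<bullet> d" by (simp add: power2_norm_eq_inner[symmetric] power2_eq_square)
  have "M * cos (?a + ?b) = (norm y * norm d * cos ?a) * (norm d * norm d' * cos ?b)
      - (norm y * norm d * sin ?a) * (norm d * norm d' * sin ?b)"
    by (simp add: cos_add M_def algebra_simps)
  also have "\<dots> = (y \<bullet> d) * (d \<bullet> d') - (\<sigma> * \<sigma>) * (cross2 y d * cross2 d d')"
    unfolding trig by (simp add: algebra_simps)
  also have "\<dots> = (d \<bullet> d) * (y \<bullet> d')"
    unfolding \<sigma>2 by (simp add: inner_plane cross2_def algebra_simps)
  also have "\<dots> = M * cos ?c" unfolding M' trig dn ..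
  finally have cos_eq: "cos (?a + ?b) = cos ?c" using M by simp
  have "M * sin (?a + ?b) = (norm y * norm d * sin ?a) * (norm d * norm d' * cos ?b)
      + (norm y * norm d * cos ?a) * (norm d * norm d' * sin ?b)"
    by (simp add: sin_add M_def algebra_simps)
  also have "\<dots> = (d \<bullet> d) * (\<sigma> * cross2 y d')"
    unfolding trig by (simp add: inner_plane cross2_def algebra_simps)
  also have "\<dots> = M * sin ?c" unfolding M' trig dn ..
  finally have sin_eq: "sin (?a + ?b) = sin ?c" using M by simp
  \<comment> \<open>Keeps the sum below \<open>2 * pi\<close>, so that the sine is strictly negative
    on the range to be excluded.\<close>
  have "?b < pi"
  proof (rule ccontr)
    assume "\<not> ?b < pi"
    then have "?b = pi" using vangle_bounds(2)[of d d'] by simp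
    then show False using trig(5) dd by auto
  qed
  have "?a + ?b \<le> pi"
  proof (rule ccontr)
    assume "\<not> ?a + ?b \<le> pi"
    moreover have "?a + ?b < 2 * pi" using \<open>?b < pi\<close> vangle_bounds(2)[of y d] by simp
    ultimately have "sin (?a + ?b) < 0" by (intro sin_lt_zero) auto
    moreover have "sin ?c \<ge> 0" by (intro sin_ge_zero vangle_bounds)
    ultimately show False using sin_eq by simp
  qed
  moreover have "0 \<le> ?a + ?b" by (intro add_nonneg_nonneg vangle_bounds)
  ultimately have "?a + ?b = ?c" using cos_inj_pi[OF _ _ vangle_bounds cos_eq] by blast
  then show ?thesis by simp
qed

text \<open>The two curves cross at \<open>c = t - x u - z u'\<close>. If \<open>y\<close> were a positive combination of \<open>u\<close> and
  \<open>u'\<close>, the ray \<open>t - r y\<close> would stay on the positive side of both curves, and comparing its slope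
  with \<open>x\<close> and \<open>z\<close> on either curve would give contradictory inequalities.\<close>

lemma no_wrap:
  assumes C: "line_graph k u C" and C': "line_graph k u' C'" and c: "c \<in> C" "c \<in> C'"
    and uu: "0 < \<sigma> * cross2 u u'"
    and height: "\<sigma> * cross2 u c \<le> \<sigma> * cross2 u t"
    and pos: "0 < offset u C t" "0 < offset u' C' t"
    and ray: "\<And>r. 0 \<le> r \<Longrightarrow> t - r *\<^sub>R y \<notin> C" "\<And>r. 0 \<le> r \<Longrightarrow> t - r *\<^sub>R y \<notin> C'"
    and yu: "0 \<le> \<sigma> * cross2 y (- u)"
  shows "0 \<le> \<sigma> * cross2 y (- u')"
proof (rule ccontr)
  assume neg: "\<not> 0 \<le> \<sigma> * cross2 y (- u')"
  have \<sigma>: "\<sigma> \<noteq> 0" and D: "cross2 u u' \<noteq> 0" using uu by auto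
  have quot: "p / cross2 u u' = (\<sigma> * p) / (\<sigma> * cross2 u u')" for p using \<sigma> by simp
  \<comment> \<open>Coordinates of \<open>y\<close> in the basis \<open>u\<close>,
    \<open>u'\<close>: the negated goal gives \<open>a > 0\<close>, and \<open>yu\<close> gives
    \<open>b \<ge> 0\<close>.\<close>
  define a b where "a = cross2 y u' / cross2 u u'" and "b = cross2 u y / cross2 u u'"
  have y: "y = a *\<^sub>R u + b *\<^sub>R u'" unfolding a_def b_def by (rule cross2_decompose[OF D])
  have a: "a > 0" unfolding a_def quot using neg uu by (intro divide_pos_pos) (simp_all add: cross2_simps)
  have b: "b \<ge> 0" unfolding b_def quot
    using yu uu cross2_commute[of y u] by (intro divide_nonneg_pos) (simp_all add: cross2_simps)
  define x z where "x = cross2 (t - c) u' / cross2 u u'" and "z = cross2 u (t - c) / cross2 u u'"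
  have "t - c = x *\<^sub>R u + z *\<^sub>R u'"
    unfolding x_def z_def by (rule cross2_decompose[OF D])
  then have t: "t = c + (x *\<^sub>R u + z *\<^sub>R u')" by (simp add: diff_eq_eq add.commute)
  have z: "z \<ge> 0" unfolding z_def quot using height uu
    by (intro divide_nonneg_pos) (simp_all add: cross2_simps right_diff_distrib)
  let ?R = "(\<lambda>r. t - r *\<^sub>R y) ` {0..}"
  have con: "connected ?R"
    by (intro connected_continuous_image continuous_intros) (simp add: convex_connected)
  have mem: "t - r *\<^sub>R y \<in> ?R" if "0 \<le> r" for r using that by (intro imageI) simp
  have t0: "t \<in> ?R" using mem[of 0] by simp
  have C_ray: "0 < offset u C (t - r *\<^sub>R y)" if "0 \<le> r" for r
    by (rule offset_pos_on_connected[OF C con _ t0 pos(1) mem[OF that]]) (use ray(1) in auto)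
  have C'_ray: "0 < offset u' C' (t - r *\<^sub>R y)" if "0 \<le> r" for r
    by (rule offset_pos_on_connected[OF C' con _ t0 pos(2) mem[OF that]]) (use ray(2) in auto)
  have c0: "offset u C c = 0" "offset u' C' c = 0"
    using offset_zero_iff[OF C] offset_zero_iff[OF C'] c by auto
  show False
  proof (cases "b = 0")
    case True
    \<comment> \<open>Here \<open>y\<close> is a positive multiple of \<open>u\<close>, and the ray
      runs into the foot of \<open>t\<close> on \<open>C\<close>.\<close>
    define r where "r = offset u C t / a"
    have "t - r *\<^sub>R y = t - offset u C t *\<^sub>R u" using a by (simp add: y True r_def)
    then have "offset u C (t - r *\<^sub>R y) = 0" by (simp add: offset_shift'[OF C])
    moreover have "0 \<le> r" using a pos by (simp add: r_def)
    ultimately show False using C_ray[of r] by simp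
  next
    case False
    then have b: "b > 0" using b by simp
    \<comment> \<open>At \<open>r = z / b\<close> the ray reaches the line through \<open>c\<close>
      in direction \<open>u\<close>, where the offset from \<open>C\<close> can be read off;
      \<open>r = x / a\<close> does the same for \<open>u'\<close> and \<open>C'\<close>.\<close>
    have "t - (z / b) *\<^sub>R y = c + (x - z / b * a) *\<^sub>R u"
      using b by (simp add: t y algebra_simps)
    then have "offset u C (t - (z / b) *\<^sub>R y) = x - z / b * a"
      using offset_shift[OF C, of c] c0 by simp
    then have "0 < x - z / b * a" using C_ray[of "z / b"] b z by simp
    then have 1: "z * a < x * b" using b by (simp add: field_simps)
    moreover have "0 \<le> z * a" using z a by simp
    ultimately have "0 < x * b" by linarith
    then have x: "0 < x" using b by (simp add: zero_less_mult_iff)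
    have "t - (x / a) *\<^sub>R y = c + (z - x / a * b) *\<^sub>R u'"
      using a by (simp add: t y algebra_simps)
    then have "offset u' C' (t - (x / a) *\<^sub>R y) = z - x / a * b"
      using offset_shift[OF C', of c] c0 by simp
    then have "0 < z - x / a * b" using C'_ray[of "x / a"] a x by simp
    then have "x * b < z * a" using a by (simp add: field_simps)
    then show False using 1 by simp
  qed
qed

section \<open>Classes of worms and chains of tiles\<close>

definition worm_class :: "plane set set \<Rightarrow> plane \<Rightarrow> (int \<Rightarrow> plane) \<Rightarrow> (int \<Rightarrow> plane) \<Rightarrow> (int \<Rightarrow> plane set) set" where
  "worm_class \<T> u c v = worm_rel \<T> `` {\<lambda>i. para (c i) u (v i)}"

definition linked :: "plane set set \<Rightarrow> (int \<Rightarrow> plane set) set set \<Rightarrow> (plane set \<times> plane set) set" where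
  "linked \<T> \<W> = {(A, B). A \<in> \<T> \<and> B \<in> \<T> \<and> (\<exists>W\<in>\<W>. neighbours_in_worm W A B)}"

lemma linked_mono: "\<W> \<subseteq> \<V> \<Longrightarrow> (linked \<T> \<W>)\<^sup>* \<subseteq> (linked \<T> \<V>)\<^sup>*"
  unfolding linked_def by (rule rtrancl_mono) blast

lemma worm_data_sequence:
  assumes "worm_data \<T> \<sigma> u c v"
  shows "worm_sequence \<T> (\<lambda>i. para (c i) u (v i))"
proof -
  note W = worm_dataD[OF assms]
  define e where "e i = closed_segment (c i + v i - u) (c i + v i + u)" for i
  have e1: "e i edge_of para (c i) u (v i)" for i
    unfolding e_def by (rule edge_of_para[OF W(4)])
  have e2: "e i edge_of para (c (i + 1)) u (v (i + 1))" for i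
  proof -
    have "c (i + 1) + - v (i + 1) = c i + v i" using W(3)[of i] by simp
    moreover have "cross2 u (- v (i + 1)) \<noteq> 0" using W(4) by (simp add: cross2_simps)
    ultimately show ?thesis
      using edge_of_para[of u "- v (i + 1)" "c (i + 1)"] by (simp add: e_def para_uminus)
  qed
  \<comment> \<open>Consecutive shared edges are translates, hence parallel; they differ because
    \<open>cross2 u\<close> is constant on each, with distinct values.\<close>
  have shift: "e (i + 1) = (+) (2 *\<^sub>R v (i + 1)) ` e i" for i
  proof -
    have "c (i + 1) + v (i + 1) = 2 *\<^sub>R v (i + 1) + (c i + v i)"
      using W(3)[of i] by (simp add: scaleR_2 algebra_simps)
    then show ?thesis
      unfolding e_def closed_segment_translation[symmetric] by (simp add: add_diff_eq add.assoc)
  qed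
  have par: "parallel_edges (e (i + 1)) (e i)" for i
  proof -
    have "affine hull (e i) = (+) (- (2 *\<^sub>R v (i + 1))) ` (affine hull (e (i + 1)))"
      unfolding shift affine_hull_translation by (simp add: image_image)
    then show ?thesis unfolding parallel_edges_def affine_parallel_def by (intro exI)
  qed
  have height: "cross2 u p = cross2 u (c i + v i)" if mem: "p \<in> e i" for p i
  proof -
    obtain s where p: "p = (1 - s) *\<^sub>R (c i + v i - u) + s *\<^sub>R (c i + v i + u)"
      using mem unfolding e_def in_segment by auto
    show ?thesis unfolding p cross2_simps by (simp add: algebra_simps)
  qed
  have ne: "e (i + 1) \<noteq> e i" for i
  proof
    assume eq: "e (i + 1) = e i"
    have mem: "c i + v i - u \<in> e i" by (simp add: e_def)
    have "cross2 u (c (i + 1) + v (i + 1)) = cross2 u (c i + v i)"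
      using height[OF mem] height[OF mem[folded eq]] by simp
    then show False unfolding W(3)[of i] cross2_simps using W(4)[of "i + 1"] by simp
  qed
  have tne: "para (c (i + 1)) u (v (i + 1)) \<noteq> para (c i) u (v i)" for i
  proof
    assume "para (c (i + 1)) u (v (i + 1)) = para (c i) u (v i)"
    from para_centre_unique[OF W(4) this] have "c i = c i + (v i + v (i + 1))"
      using W(3)[of i] by (simp only: add.assoc)
    then have "v i + v (i + 1) = 0" by simp
    then have "v (i + 1) = - v i" by (simp add: add_eq_0_iff)
    then show False using W(2)[of i] W(2)[of "i + 1"] by (simp add: cross2_simps)
  qed
  have "worm_given_by \<T> (para (c 0) u (v 0)) (e 0) (\<lambda>i. para (c i) u (v i))"
    unfolding worm_given_by_def using W(1) tne e1 e2 ne par by blast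
  then show ?thesis unfolding worm_sequence_def using W(1) e1 by blast
qed

lemma worm_class_in_worms:
  assumes "worm_data \<T> \<sigma> u c v"
  shows "worm_class \<T> u c v \<in> worms \<T>"
  unfolding worm_class_def worms_def by (rule quotientI) (use worm_data_sequence[OF assms] in simp)

lemma worm_in_class:
  assumes "worm_data \<T> \<sigma> u c v"
  shows "(\<lambda>i. para (c i) u (v i)) \<in> worm_class \<T> u c v"
proof -
  have "\<exists>k::int. (\<lambda>i. para (c i) u (v i)) = (\<lambda>i. para (c (i + k)) u (v (i + k)))"
    by (rule exI[of _ 0]) simp
  then show ?thesis
    using worm_data_sequence[OF assms] unfolding worm_class_def worm_rel_def by blast
qed

lemma linked_in_worm:
  assumes W: "worm_data \<T> \<sigma> u c v" and "A \<in> worm_tiles u c v" "B \<in> worm_tiles u c v"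
    and \<W>: "worm_class \<T> u c v \<in> \<W>"
  shows "(A, B) \<in> (linked \<T> \<W>)\<^sup>*"
proof -
  let ?w = "\<lambda>i. para (c i) u (v i)"
  have nb: "neighbours_in_worm (worm_class \<T> u c v) (?w i) (?w (i + 1))"
    "neighbours_in_worm (worm_class \<T> u c v) (?w (i + 1)) (?w i)" for i
    unfolding neighbours_in_worm_def
    by (rule bexI[OF _ worm_in_class[OF W]], rule exI[of _ i], simp)+
  have step: "(?w i, ?w (i + 1)) \<in> linked \<T> \<W>" "(?w (i + 1), ?w i) \<in> linked \<T> \<W>" for i
    unfolding linked_def
    by (intro CollectI case_prodI conjI worm_dataD(1)[OF W] bexI[OF _ \<W>] nb)+
  have "(?w i, ?w (i + int n)) \<in> (linked \<T> \<W>)\<^sup>* \<and> (?w (i + int n), ?w i) \<in> (linked \<T> \<W>)\<^sup>*" for i n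
  proof (induction n)
    case (Suc n)
    have eq: "i + int (Suc n) = i + int n + 1" by simp
    show ?case
      unfolding eq
      using rtrancl_into_rtrancl[OF conjunct1[OF Suc] step(1)]
        converse_rtrancl_into_rtrancl[OF step(2) conjunct2[OF Suc]] by (rule conjI)
  qed simp
  note path = this
  obtain i j where ij: "A = ?w i" "B = ?w j" using assms(2,3) unfolding worm_tiles_def by blast
  show ?thesis
  proof (cases "i \<le> j")
    case True
    then show ?thesis using path[of i "nat (j - i)"] ij by simp
  next
    case False
    then show ?thesis using path[of j "nat (i - j)"] ij by simp
  qed
qed

context angled_tiling
begin

text \<open>The foot \<open>t - s u\<close> of \<open>t\<close> on \<open>C\<close> is a point of
  \<open>D\<close> plus \<open>r y\<close> with \<open>r > 0\<close>. As \<open>t\<close> is on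
  \<open>D\<close> too, the slope bound of \<open>D\<close> applies to \<open>- s u - r y\<close>;
  it turns into \<open>sin (vangle y (- u) + \<alpha>) > 0\<close>.\<close>

lemma angle_bound:
  assumes W: "line_graph k u C" and Y: "line_graph (cot \<alpha>) y D" and t: "t \<in> D"
    and pos: "\<And>p. p \<in> C \<Longrightarrow> 0 < offset y D p" and off: "0 < offset u C t"
    and \<sigma>: "\<sigma> = 1 \<or> \<sigma> = -1" and yu: "0 \<le> \<sigma> * cross2 y (- u)"
  shows "vangle y (- u) < pi - \<alpha>"
proof -
  have nz: "y \<noteq> 0" "- u \<noteq> 0" using graph_dir_nonzero[OF W] graph_dir_nonzero[OF Y] by auto
  define s p r where "s = offset u C t" and "p = t - s *\<^sub>R u" and "r = offset y D p"
  have "p \<in> C" unfolding p_def s_def by (rule offset_mem[OF W])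
  then have r: "r > 0" using pos by (simp add: r_def)
  have s: "s > 0" using off by (simp add: s_def)
  have "p - r *\<^sub>R y \<in> D" unfolding r_def by (rule offset_mem[OF Y])
  from graph_cone[OF Y t this]
  have cone: "\<bar>y \<bullet> ((p - r *\<^sub>R y) - t)\<bar> \<le> cot \<alpha> * \<bar>cross2 y ((p - r *\<^sub>R y) - t)\<bar>" .
  have d: "(p - r *\<^sub>R y) - t = s *\<^sub>R (- u) - r *\<^sub>R y" by (simp add: p_def)
  have "\<bar>s * (y \<bullet> (- u)) - r * (y \<bullet> y)\<bar> \<le> cot \<alpha> * (s * \<bar>cross2 y (- u)\<bar>)"
    using cone s unfolding d by (simp add: inner_diff_right cross2_simps abs_mult)
  moreover have "r * (y \<bullet> y) > 0" using r nz by simp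
  ultimately have "s * (y \<bullet> (- u) + cot \<alpha> * \<bar>cross2 y (- u)\<bar>) > 0"
    by (simp add: algebra_simps)
  then have "sin \<alpha> * (y \<bullet> (- u) + cot \<alpha> * \<bar>cross2 y (- u)\<bar>) > 0"
    using s sin_\<alpha> by (simp add: zero_less_mult_iff)
  also have "sin \<alpha> * (y \<bullet> (- u) + cot \<alpha> * \<bar>cross2 y (- u)\<bar>) = sin \<alpha> * (y \<bullet> (- u)) + cos \<alpha> * \<bar>cross2 y (- u)\<bar>"
    using sin_\<alpha> by (simp add: cot_def field_simps)
  also have "\<dots> = norm y * norm (- u) * sin (vangle y (- u) + \<alpha>)"
    unfolding cos_vangle[OF nz, symmetric] sin_vangle[OF nz, symmetric] sin_add by (simp add: algebra_simps)
  finally have "sin (vangle y (- u) + \<alpha>) > 0"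
    by (rule zero_less_mult_pos) (use nz in simp)
  moreover have "vangle y (- u) + \<alpha> < 2 * pi" using vangle_bounds(2)[of y "- u"] \<alpha>_le pi_gt_zero by linarith
  ultimately show ?thesis using sin_le_zero[of "vangle y (- u) + \<alpha>"] by linarith
qed

lemma axis_offset_pos:
  assumes W: "worm_data \<T> \<sigma> u c v" and "\<sigma> = 1 \<or> \<sigma> = -1" and Y: "worm_data \<T> \<tau> y d w" and "\<tau> = 1 \<or> \<tau> = -1"
    and disj: "worm_tiles u c v \<inter> worm_tiles y d w = {}"
    and a: "a \<in> axis c v" "0 < offset y (axis d w) a" and p: "p \<in> axis c v"
  shows "0 < offset y (axis d w) p"
proof (rule offset_pos_on_connected[OF worm_line_graph[OF Y assms(4)]])
  show "connected (axis c v)" by (rule connected_graph[OF worm_line_graph[OF W assms(2)]])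
  show "axis c v \<inter> axis d w = {}" using axes_meet[OF W Y] disj by blast
qed (use a p in auto)

text \<open>The worms \<open>W\<close>, \<open>W'\<close>, \<dots> spiral around \<open>t\<close>: as long as they do not meet the worm \<open>Y\<close> through
  \<open>t\<close>, the angle from \<open>y\<close> to \<open>- u\<close> grows by at least \<open>\<alpha>\<close> in each step and stays below \<open>pi - \<alpha>\<close>.\<close>

lemma spiral:
  assumes \<sigma>: "\<sigma> = 1 \<or> \<sigma> = -1" and Y: "worm_data \<T> \<sigma> y d w" and t: "t \<in> axis d w"
    and B: "B \<in> worm_tiles y d w"
    and W: "worm_data \<T> \<sigma> u c v" and A: "A \<in> worm_tiles u c v"
    and pos: "\<And>p. p \<in> axis c v \<Longrightarrow> 0 < offset y (axis d w) p"
    and off: "0 < offset u (axis c v) t" and yu: "0 \<le> \<sigma> * cross2 y (- u)"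
    and N: "pi - \<alpha> - vangle y (- u) \<le> real N * \<alpha>"
  shows "\<exists>\<W> \<subseteq> worms \<T>. finite \<W> \<and> card \<W> \<le> N + 2 \<and> (A, B) \<in> (linked \<T> \<W>)\<^sup>*"
  using W A pos off yu N
proof (induction N arbitrary: u c v A)
  case 0
  \<comment> \<open>With no steps left the angle would be at least \<open>pi - \<alpha>\<close>,
    which \<open>angle_bound\<close> excludes: the case is vacuous.\<close>
  note W = worm_line_graph[OF 0(1) \<sigma>]
  from angle_bound[OF W worm_line_graph[OF Y \<sigma>] t 0(3,4) \<sigma> 0(5)] 0(6) show ?case by simp
next
  case (Suc N)
  note W = Suc.prems(1) and gW = worm_line_graph[OF Suc.prems(1) \<sigma>] and gY = worm_line_graph[OF Y \<sigma>]
  obtain i c' v' where X: "worm_data \<T> \<sigma> (v i) c' v'" "c' 0 = c i" "v' 0 = - u"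
    and height: "\<sigma> * cross2 u (c i) \<le> \<sigma> * cross2 u t" and off': "0 \<le> offset (v i) (axis c' v') t"
    using next_worm[OF W \<sigma>] by blast
  note gX = worm_line_graph[OF X(1) \<sigma>]
  let ?A = "para (c i) u (v i)"
  have "?A = para (c' 0) (v i) (v' 0)" by (simp add: X para_uminus para_swap)
  then have A': "?A \<in> worm_tiles u c v" "?A \<in> worm_tiles (v i) c' v'"
    unfolding worm_tiles_def by blast+
  let ?W = "worm_class \<T> u c v" and ?X = "worm_class \<T> (v i) c' v'" and ?Y = "worm_class \<T> y d w"
  have cls: "?W \<in> worms \<T>" "?X \<in> worms \<T>" "?Y \<in> worms \<T>"
    using worm_class_in_worms W X(1) Y by blast+
  show ?case
  proof (cases "worm_tiles (v i) c' v' \<inter> worm_tiles y d w = {}")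
    case False
    then obtain B' where B': "B' \<in> worm_tiles (v i) c' v'" "B' \<in> worm_tiles y d w" by blast
    \<comment> \<open>The final step uses three worms, the least value of
      \<open>Suc N + 2\<close>.\<close>
    let ?V = "{?W, ?X, ?Y}"
    have "(A, ?A) \<in> (linked \<T> ?V)\<^sup>*" by (rule linked_in_worm[OF W Suc.prems(2) A'(1)]) simp
    moreover have "(?A, B') \<in> (linked \<T> ?V)\<^sup>*" by (rule linked_in_worm[OF X(1) A'(2) B'(1)]) simp
    moreover have "(B', B) \<in> (linked \<T> ?V)\<^sup>*" by (rule linked_in_worm[OF Y B'(2) B]) simp
    ultimately have "(A, B) \<in> (linked \<T> ?V)\<^sup>*" by (meson rtrancl_trans)
    moreover have "card ?V \<le> 3" using card_insert_le_m1 by (simp add: card_insert_if)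
    ultimately show ?thesis using cls by (intro exI[of _ ?V]) auto
  next
    case True
    have disj: "axis c' v' \<inter> axis d w = {}" using axes_meet[OF X(1) Y] True by blast
    have ci: "c i \<in> axis c v" "c i \<in> axis c' v'"
      using centre_in_axis[of c i v] centre_in_axis[of c' 0 v'] X(2) by simp_all
    have pos': "0 < offset y (axis d w) p" if "p \<in> axis c' v'" for p
      by (rule axis_offset_pos[OF X(1) \<sigma> Y \<sigma> True ci(2) Suc.prems(3)[OF ci(1)] that])
    \<comment> \<open>\<open>t\<close> is on the axis of \<open>Y\<close>, which the new axis
      avoids, so the weak inequality becomes strict.\<close>
    have "offset (v i) (axis c' v') t \<noteq> 0" using offset_zero_iff[OF gX] t disj by blast
    then have off'': "0 < offset (v i) (axis c' v') t" using off' by simp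
    \<comment> \<open>The ray from \<open>t\<close> in direction \<open>- y\<close> has offsets at
      most 0 from \<open>Y\<close>, while both axes lie on the positive side, so it meets
      neither.\<close>
    have ray: "offset y (axis d w) (t - r *\<^sub>R y) = - r" for r
      using offset_shift'[OF gY, of t r] offset_zero_iff[OF gY, of t] t by simp
    have uv: "0 < \<sigma> * cross2 u (v i)" by (rule worm_dataD(2)[OF W])
    have yv: "0 \<le> \<sigma> * cross2 y (- v i)"
    proof (rule no_wrap[OF gW gX ci uv height Suc.prems(4) off'' _ _ Suc.prems(5)])
      show "t - r *\<^sub>R y \<notin> axis c v" "t - r *\<^sub>R y \<notin> axis c' v'" if "0 \<le> r" for r
        using ray[of r] that Suc.prems(3)[of "t - r *\<^sub>R y"] pos'[of "t - r *\<^sub>R y"] by auto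
    qed
    have "vangle y (- v i) = vangle y (- u) + vangle (- u) (- v i)"
      by (rule vangle_add[OF \<sigma> graph_dir_nonzero[OF gY] Suc.prems(5) _ yv])
        (use uv in \<open>simp add: cross2_simps\<close>)
    moreover have "\<alpha> \<le> vangle u (v i)" by (rule angle_ge[OF worm_dataD(1,4)[OF W]])
    ultimately have "pi - \<alpha> - vangle y (- v i) \<le> real N * \<alpha>"
      using Suc.prems(6) by (simp add: vangle_uminus_both algebra_simps)
    from Suc.IH[OF X(1) A'(2) pos' off'' yv this]
    obtain \<V> where \<V>: "\<V> \<subseteq> worms \<T>" "finite \<V>" "card \<V> \<le> N + 2" "(?A, B) \<in> (linked \<T> \<V>)\<^sup>*"
      by blast
    let ?V = "insert ?W \<V>"
    have "(A, ?A) \<in> (linked \<T> ?V)\<^sup>*" by (rule linked_in_worm[OF W Suc.prems(2) A'(1)]) simp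
    moreover have "(?A, B) \<in> (linked \<T> ?V)\<^sup>*"
      using \<V>(4) linked_mono[of \<V> ?V \<T>] by blast
    ultimately have "(A, B) \<in> (linked \<T> ?V)\<^sup>*" by (meson rtrancl_trans)
    moreover have "card ?V \<le> Suc N + 2" using \<V>(2,3) by (simp add: card_insert_if)
    ultimately show ?thesis using cls \<V>(1,2) by (intro exI[of _ ?V]) auto
  qed
qed

lemma connected_by_worms:
  assumes "S \<in> \<T>" "T \<in> \<T>"
  shows "\<exists>\<W> \<subseteq> worms \<T>. finite \<W> \<and> real (card \<W>) < 2 * pi / \<alpha> \<and> (S, T) \<in> (linked \<T> \<W>)\<^sup>*"
proof -
  have through: "\<exists>\<sigma> c u v. (\<sigma> = 1 \<or> \<sigma> = -1) \<and> worm_data \<T> \<sigma> u c v \<and> P \<in> worm_tiles u c v" if P: "P \<in> \<T>" for P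
  proof -
    obtain p u b where pub: "P = para p u b" "cross2 u b \<noteq> 0" using tile_para P by blast
    define \<sigma> :: real where "\<sigma> = sgn (cross2 u b)"
    have "\<sigma> * cross2 u b > 0" using pub(2) by (simp add: \<sigma>_def sgn_if)
    then obtain c v where "worm_data \<T> \<sigma> u c v" "c 0 = p" "v 0 = b"
      using worm_exists P pub(1) by metis
    moreover have "P \<in> worm_tiles u c v" using calculation pub(1) unfolding worm_tiles_def by blast
    moreover have "\<sigma> = 1 \<or> \<sigma> = -1" using pub(2) by (auto simp: \<sigma>_def sgn_if)
    ultimately show ?thesis by blast
  qed
  obtain \<sigma>1 c1 u1 v1 where W1: "\<sigma>1 = 1 \<or> \<sigma>1 = -1" "worm_data \<T> \<sigma>1 u1 c1 v1" "S \<in> worm_tiles u1 c1 v1"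
    using through[OF assms(1)] by blast
  obtain \<sigma>2 d1 y1 w1 where Y1: "\<sigma>2 = 1 \<or> \<sigma>2 = -1" "worm_data \<T> \<sigma>2 y1 d1 w1" "T \<in> worm_tiles y1 d1 w1"
    using through[OF assms(2)] by blast
  have \<alpha>4: "2 \<le> pi / \<alpha>" using \<alpha>_le \<alpha>_pos by (simp add: field_simps)
  show ?thesis
  proof (cases "worm_tiles u1 c1 v1 \<inter> worm_tiles y1 d1 w1 = {}")
    case False
    then obtain B where B: "B \<in> worm_tiles u1 c1 v1" "B \<in> worm_tiles y1 d1 w1" by blast
    let ?V = "{worm_class \<T> u1 c1 v1, worm_class \<T> y1 d1 w1}"
    have "(S, B) \<in> (linked \<T> ?V)\<^sup>*" by (rule linked_in_worm[OF W1(2,3) B(1)]) simp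
    moreover have "(B, T) \<in> (linked \<T> ?V)\<^sup>*" by (rule linked_in_worm[OF Y1(2) B(2) Y1(3)]) simp
    ultimately have "(S, T) \<in> (linked \<T> ?V)\<^sup>*" by (meson rtrancl_trans)
    moreover have "card ?V \<le> 2" by (simp add: card_insert_if)
    then have "real (card ?V) < 2 * pi / \<alpha>" using \<alpha>4 by simp
    moreover have "?V \<subseteq> worms \<T>" using worm_class_in_worms[OF W1(2)] worm_class_in_worms[OF Y1(2)] by blast
    ultimately show ?thesis by (intro exI[of _ ?V]) simp
  next
    case True
    note g1 = worm_line_graph[OF W1(2,1)] and g2 = worm_line_graph[OF Y1(2,1)]
    have disj: "axis c1 v1 \<inter> axis d1 w1 = {}" using axes_meet[OF W1(2) Y1(2)] True by blast
    define t a where "t = d1 0" and "a = c1 0"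
    have t: "t \<in> axis d1 w1" and a: "a \<in> axis c1 v1" by (simp_all add: t_def a_def centre_in_axis)
    \<comment> \<open>Three free signs: \<open>u\<close> puts \<open>t\<close> on the positive side
      of the worm through \<open>S\<close>, \<open>y\<close> puts that worm on the positive side of
      \<open>Y\<close>, and \<open>\<sigma>\<close> is the sense of rotation that leads from
      \<open>y\<close> to \<open>- u\<close> within half a turn.\<close>
    define u where "u = (if 0 < offset u1 (axis c1 v1) t then u1 else - u1)"
    define y where "y = (if 0 < offset y1 (axis d1 w1) a then y1 else - y1)"
    define \<sigma> :: real where "\<sigma> = (if 0 \<le> cross2 y (- u) then 1 else -1)"
    have u: "u = u1 \<or> u = - u1" and y: "y = y1 \<or> y = - y1" and \<sigma>: "\<sigma> = 1 \<or> \<sigma> = -1"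
      and yu: "0 \<le> \<sigma> * cross2 y (- u)"
      by (auto simp: u_def y_def \<sigma>_def)
    have "offset u1 (axis c1 v1) t \<noteq> 0" using offset_zero_iff[OF g1] t disj by blast
    then have off: "0 < offset u (axis c1 v1) t"
      by (simp add: u_def offset_uminus[OF g1])
    have "offset y1 (axis d1 w1) a \<noteq> 0" using offset_zero_iff[OF g2] a disj by blast
    then have offa: "0 < offset y (axis d1 w1) a"
      by (simp add: y_def offset_uminus[OF g2])
    obtain c v where W: "worm_data \<T> \<sigma> u c v" "axis c v = axis c1 v1" "worm_tiles u c v = worm_tiles u1 c1 v1"
      using worm_data_orient[OF W1(2,1) \<sigma> u] by blast
    obtain d w where Y: "worm_data \<T> \<sigma> y d w" "axis d w = axis d1 w1" "worm_tiles y d w = worm_tiles y1 d1 w1"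
      using worm_data_orient[OF Y1(2,1) \<sigma> y] by blast
    \<comment> \<open>The initial angle may be 0, so \<open>N\<close> steps must make up all of
      \<open>pi - \<alpha>\<close>. Rounding up costs less than one step, hence
      \<open>N < pi / \<alpha>\<close>.\<close>
    define N where "N = nat \<lceil>(pi - \<alpha>) / \<alpha>\<rceil>"
    have q: "0 \<le> (pi - \<alpha>) / \<alpha>" using \<alpha>_le \<alpha>_pos pi_gt_zero by (intro divide_nonneg_pos) linarith+
    have N: "(pi - \<alpha>) / \<alpha> \<le> real N" "real N < (pi - \<alpha>) / \<alpha> + 1"
      using q by (auto simp: N_def of_nat_nat le_of_int_ceiling) linarith
    have "pi - \<alpha> \<le> real N * \<alpha>" using N(1) \<alpha>_pos by (simp add: field_simps)
    then have bound: "pi - \<alpha> - vangle y (- u) \<le> real N * \<alpha>" using vangle_bounds(1)[of y "- u"] by linarith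
    have "\<exists>\<W> \<subseteq> worms \<T>. finite \<W> \<and> card \<W> \<le> N + 2 \<and> (S, T) \<in> (linked \<T> \<W>)\<^sup>*"
    proof (rule spiral[OF \<sigma> Y(1) _ _ W(1) _ _ _ yu bound])
      show "t \<in> axis d w" "T \<in> worm_tiles y d w" "S \<in> worm_tiles u c v" "0 < offset u (axis c v) t"
        using t Y1(3) W1(3) off W Y by simp_all
      show "0 < offset y (axis d w) p" if "p \<in> axis c v" for p
        by (rule axis_offset_pos[OF W(1) \<sigma> Y(1) \<sigma> _ _ _ that, of a]) (use True a offa W Y in simp_all)
    qed
    moreover have "real (N + 2) < 2 * pi / \<alpha>"
    proof -
      have "(pi - \<alpha>) / \<alpha> + 1 = pi / \<alpha>" using \<alpha>_pos by (simp add: field_simps)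
      then show ?thesis using N(2) \<alpha>4 by simp
    qed
    ultimately show ?thesis by (meson le_less_trans of_nat_mono)
  qed
qed

end

lemma vangle_in_interior_angles:
  assumes "cross2 u v \<noteq> 0"
  shows "vangle u v \<in> interior_angles (para c u v)"
proof -
  let ?x = "c - u - v" and ?y = "c + u - v" and ?z = "c - u + v"
  have "closed_segment (c + (- v) - u) (c + (- v) + u) edge_of para c u (- v)"
    by (rule edge_of_para) (use assms in \<open>simp add: cross2_simps\<close>)
  then have 1: "closed_segment ?x ?y edge_of para c u v"
    by (simp add: para_uminus algebra_simps)
  have "closed_segment (c + (- u) - v) (c + (- u) + v) edge_of para c v (- u)"
    by (rule edge_of_para) (use assms cross2_commute[of u v] in \<open>simp add: cross2_simps\<close>)
  then have 2: "closed_segment ?x ?z edge_of para c u v"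
    by (simp add: para_uminus para_swap algebra_simps)
  have "?y \<noteq> ?z" using assms by (auto simp: plane_eq_iff cross2_def)
  moreover have "?y - ?x = 2 *\<^sub>R u" "?z - ?x = 2 *\<^sub>R v" by (simp_all add: scaleR_2)
  then have "vangle u v = arccos ((?y - ?x) \<bullet> (?z - ?x) / (norm (?y - ?x) * norm (?z - ?x)))"
    by (simp add: vangle_def)
  ultimately show ?thesis unfolding interior_angles_def using 1 2 by blast
qed

theorem lemma2p4:
  fixes \<T> :: "plane set set" and \<alpha> :: real and S T :: "plane set"
  assumes "parallelogram_tiling \<T>"
    and "locally_finite_tiling \<T>"
    and "vertex_to_vertex \<T>"
    and "\<alpha> = Inf (\<Union>P\<in>protoset \<T>. prototile_angles P)"
    and "\<alpha> > 0"
    and "S \<in> \<T>" and "T \<in> \<T>"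
  shows "\<exists>\<W> n C. \<W> \<subseteq> worms \<T> \<and> finite \<W> \<and> int (card \<W>) < \<lceil>2 * pi / \<alpha>\<rceil> \<and>
           C 0 = S \<and> C n = T \<and> (\<forall>i\<le>n. C i \<in> \<T>) \<and>
           (\<forall>i<n. \<exists>W\<in>\<W>. neighbours_in_worm W (C i) (C (Suc i)))"
proof -
  interpret angled_tiling \<T> \<alpha>
  proof
    fix c u v assume A: "para c u v \<in> \<T>" "cross2 u v \<noteq> 0"
    let ?I = "\<Union>P\<in>protoset \<T>. prototile_angles P"
    let ?E = "{(A, B). A \<in> \<T> \<and> B \<in> \<T> \<and> congruent_sets A B}"
    have "congruent_sets (para c u v) (para c u v)"
      unfolding congruent_sets_def by (rule exI[of _ id]) simp
    then have "para c u v \<in> ?E `` {para c u v}" using A by simp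
    moreover have "?E `` {para c u v} \<in> protoset \<T>"
      unfolding protoset_def using A(1) by (rule quotientI)
    ultimately have "vangle u v \<in> ?I"
      using vangle_in_interior_angles[OF A(2), of c] unfolding prototile_angles_def by blast
    \<comment> \<open>A real \<open>Inf\<close> is guaranteed to be a lower bound only for a set
      that is bounded below.\<close>
    moreover have "bdd_below ?I"
    proof (rule bdd_belowI)
      fix x assume "x \<in> ?I"
      then obtain p q :: plane where "x = vangle p q"
        unfolding prototile_angles_def interior_angles_def vangle_def by blast
      then show "0 \<le> x" by (simp add: vangle_bounds)
    qed
    ultimately show "\<alpha> \<le> vangle u v" unfolding assms(4) by (rule cInf_lower)
  qed (use assms in auto)
  obtain \<W> where \<W>: "\<W> \<subseteq> worms \<T>" "finite \<W>" "real (card \<W>) < 2 * pi / \<alpha>" "(S, T) \<in> (linked \<T> \<W>)\<^sup>*"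
    using connected_by_worms[OF assms(6,7)] by blast
  obtain n where "(S, T) \<in> linked \<T> \<W> ^^ n" using rtrancl_imp_relpow[OF \<W>(4)] by blast
  then obtain C where C: "C 0 = S" "C n = T" "\<And>i. i < n \<Longrightarrow> (C i, C (Suc i)) \<in> linked \<T> \<W>"
    unfolding relpow_fun_conv by blast
  have "C i \<in> \<T>" if "i \<le> n" for i
  proof (cases "i < n")
    case True
    then show ?thesis using C(3)[of i] unfolding linked_def by blast
  next
    case False
    then show ?thesis using that C(2) assms(7) by simp
  qed
  moreover have "\<exists>W\<in>\<W>. neighbours_in_worm W (C i) (C (Suc i))" if "i < n" for i
    using C(3)[OF that] unfolding linked_def by blast
  \<comment> \<open>An integer is below the ceiling of a number exactly when it is below the number
    itself.\<close>
  moreover have "int (card \<W>) < \<lceil>2 * pi / \<alpha>\<rceil>" using \<W>(3) by (simp add: less_ceiling_iff)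
  ultimately show ?thesis using \<W>(1,2) C(1,2) by blast
qed

end
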